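(* Let $G$ be a totally disconnected, locally compact group that has a lattice $H$ in which every element is infinitely divisible. Then $G$ is uniscalar. However, $G$ need not be anisotropic: there exists a totally disconnected, locally compact group that has a lattice in which every element is infinitely divisible and that is not anisotropic.
   Context: Let $G$ be a (Hausdorff) totally disconnected, locally compact group with identity $e$. A lattice in $G$ is a closed subgroup $H$ that is discrete in the subspace topology and has finite co-volume, meaning that the coset space $G/H$ supports a nonzero finite $G$-invariant Radon measure. An element $x\in G$ is infinitely divisible if there are a strictly increasing sequence $(n_k)$ of positive integers and a sequence $(x_k)$ of elements of $G$ such that $x = x_k^{n_k}$ for every $k$. The scale on $G$ is the function $s_G: G\to\mathbb{Z}^+$ defined by $s_G(x) := \min\{[xVx^{-1}: xVx^{-1}\cap V] : V\leqslant G,\ V \text{ compact and open}\}$. The contraction subgroup for $x\in G$ is $\mathsf{con}(x) := \{g\in G \mid x^n g x^{-n}\to e \text{ as } n\to\infty\}$. The group $G$ is uniscalar if $s_G$ is identically equal to $1$, and anisotropic if $\mathsf{con}(x)=\{e\}$ for every $x\in G$. *)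

theory Defs
  imports "HOL-Analysis.Analysis" "HOL-Algebra.Left_Coset"
begin

locale topological_group = group G for G (structure) +
  fixes T :: "'a topology"
  assumes topspace_eq_carrier: "topspace T = carrier G"
    and continuous_mult: "continuous_map (prod_topology T T) T (\<lambda>(x, y). x \<otimes> y)"
    and continuous_inv: "continuous_map T T (\<lambda>x. inv x)"

definition totally_disconnected_space :: "'a topology \<Rightarrow> bool" where
  "totally_disconnected_space T \<longleftrightarrow> (\<forall>S. connectedin T S \<longrightarrow> (\<exists>a. S \<subseteq> {a}))"

locale tdlc_group = topological_group +
  assumes Hausdorff: "Hausdorff_space T"
    and locally_compact: "locally_compact_space T"
    and totally_disconnected: "totally_disconnected_space T"

definition quotient_topology :: "'a topology \<Rightarrow> ('a \<Rightarrow> 'b) \<Rightarrow> 'b topology" where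
  "quotient_topology T f =
     topology (\<lambda>U. U \<subseteq> f ` topspace T \<and> openin T {x \<in> topspace T. f x \<in> U})"

lemma openin_quotient_topology:
  "openin (quotient_topology T f) U \<longleftrightarrow>
     U \<subseteq> f ` topspace T \<and> openin T {x \<in> topspace T. f x \<in> U}"
proof -
  have "istopology (\<lambda>U. U \<subseteq> f ` topspace T \<and> openin T {x \<in> topspace T. f x \<in> U})"
    unfolding istopology_def
  proof (intro conjI allI impI)
    fix U V
    assume "U \<subseteq> f ` topspace T \<and> openin T {x \<in> topspace T. f x \<in> U}"
      and "V \<subseteq> f ` topspace T \<and> openin T {x \<in> topspace T. f x \<in> V}"
    moreover have "{x \<in> topspace T. f x \<in> U \<inter> V} =
        {x \<in> topspace T. f x \<in> U} \<inter> {x \<in> topspace T. f x \<in> V}"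
      by blast
    ultimately show "U \<inter> V \<subseteq> f ` topspace T" "openin T {x \<in> topspace T. f x \<in> U \<inter> V}"
      by auto
  next
    fix \<K>
    assume \<K>: "\<forall>K\<in>\<K>. K \<subseteq> f ` topspace T \<and> openin T {x \<in> topspace T. f x \<in> K}"
    then show "\<Union>\<K> \<subseteq> f ` topspace T"
      by blast
    have "{x \<in> topspace T. f x \<in> \<Union>\<K>} = \<Union>((\<lambda>K. {x \<in> topspace T. f x \<in> K}) ` \<K>)"
      by blast
    then show "openin T {x \<in> topspace T. f x \<in> \<Union>\<K>}"
      using \<K> by auto
  qed
  then show ?thesis
    by (simp add: quotient_topology_def)
qed

lemma topspace_quotient_topology: "topspace (quotient_topology T f) = f ` topspace T"
proof -
  have "{x \<in> topspace T. f x \<in> f ` topspace T} = topspace T"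
    by blast
  then have "openin (quotient_topology T f) (f ` topspace T)"
    by (simp add: openin_quotient_topology)
  then show ?thesis
    by (metis openin_quotient_topology openin_subset openin_topspace subset_antisym)
qed

lemma quotient_map_quotient_topology: "quotient_map T (quotient_topology T f) f"
  by (auto simp: quotient_map_def topspace_quotient_topology openin_quotient_topology)

text \<open>The space \<open>G/H\<close> of left cosets, whose points are the elements of \<open>lcosets H\<close>.\<close>

definition coset_topology ::
    "('a, 'b) monoid_scheme \<Rightarrow> 'a topology \<Rightarrow> 'a set \<Rightarrow> 'a set topology" where
  "coset_topology G T H = quotient_topology T (\<lambda>g. g <#\<^bsub>G\<^esub> H)"

definition radon_measure :: "'a topology \<Rightarrow> 'a measure \<Rightarrow> bool" where
  "radon_measure X M \<longleftrightarrow>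
     space M = topspace X \<and>
     sets M = sigma_sets (topspace X) {U. openin X U} \<and>
     (\<forall>K. compactin X K \<longrightarrow> emeasure M K < \<infinity>) \<and>
     (\<forall>A \<in> sets M. emeasure M A = (INF U \<in> {U. openin X U \<and> A \<subseteq> U}. emeasure M U)) \<and>
     (\<forall>U. openin X U \<longrightarrow>
        emeasure M U = (SUP K \<in> {K. compactin X K \<and> K \<subseteq> U}. emeasure M K))"

definition invariant_coset_measure ::
    "('a, 'b) monoid_scheme \<Rightarrow> 'a set measure \<Rightarrow> bool" where
  "invariant_coset_measure G M \<longleftrightarrow>
     (\<forall>g \<in> carrier G. \<forall>A \<in> sets M. emeasure M ((\<lambda>C. g <#\<^bsub>G\<^esub> C) ` A) = emeasure M A)"

definition lattice_subgroup ::
    "('a, 'b) monoid_scheme \<Rightarrow> 'a topology \<Rightarrow> 'a set \<Rightarrow> bool" where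
  "lattice_subgroup G T H \<longleftrightarrow>
     subgroup H G \<and> closedin T H \<and> subtopology T H = discrete_topology H \<and>
     (\<exists>M. radon_measure (coset_topology G T H) M \<and> invariant_coset_measure G M \<and>
          finite_measure M \<and> emeasure M (space M) \<noteq> 0)"

text \<open>The roots are taken in the ambient group \<open>G\<close>.\<close>

definition infinitely_divisible :: "('a, 'b) monoid_scheme \<Rightarrow> 'a \<Rightarrow> bool" where
  "infinitely_divisible G x \<longleftrightarrow>
     (\<exists>(n :: nat \<Rightarrow> nat) y. strict_mono n \<and>
        (\<forall>k. 0 < n k \<and> y k \<in> carrier G \<and> x = y k [^]\<^bsub>G\<^esub> n k))"

text \<open>The index \<open>[K : L]\<close> of a subgroup \<open>L\<close> of \<open>K\<close>, with value \<open>0\<close> if it is infinite.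
  In \<open>scale\<close> it is only used for \<open>L\<close> open in the compact group \<open>K\<close>, where it is finite.\<close>

definition subgroup_index ::
    "('a, 'b) monoid_scheme \<Rightarrow> 'a set \<Rightarrow> 'a set \<Rightarrow> nat" where
  "subgroup_index G K L = card (lcosets\<^bsub>G\<lparr>carrier := K\<rparr>\<^esub> L)"

definition conjugate_set :: "('a, 'b) monoid_scheme \<Rightarrow> 'a \<Rightarrow> 'a set \<Rightarrow> 'a set" where
  "conjugate_set G x V = (\<lambda>v. x \<otimes>\<^bsub>G\<^esub> v \<otimes>\<^bsub>G\<^esub> inv\<^bsub>G\<^esub> x) ` V"

text \<open>The minimum is over a set of natural numbers that is nonempty for every totally
  disconnected, locally compact group, by van Dantzig's theorem.\<close>

definition scale :: "('a, 'b) monoid_scheme \<Rightarrow> 'a topology \<Rightarrow> 'a \<Rightarrow> nat" where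
  "scale G T x =
     (LEAST n. \<exists>V. subgroup V G \<and> compactin T V \<and> openin T V \<and>
        n = subgroup_index G (conjugate_set G x V) (conjugate_set G x V \<inter> V))"

definition contraction_subgroup ::
    "('a, 'b) monoid_scheme \<Rightarrow> 'a topology \<Rightarrow> 'a \<Rightarrow> 'a set" where
  "contraction_subgroup G T x =
     {g \<in> carrier G. limitin T
        (\<lambda>n::nat. (x [^]\<^bsub>G\<^esub> n) \<otimes>\<^bsub>G\<^esub> g \<otimes>\<^bsub>G\<^esub> inv\<^bsub>G\<^esub> (x [^]\<^bsub>G\<^esub> n)) \<one>\<^bsub>G\<^esub> sequentially}"

definition uniscalar :: "('a, 'b) monoid_scheme \<Rightarrow> 'a topology \<Rightarrow> bool" where
  "uniscalar G T \<longleftrightarrow> (\<forall>x \<in> carrier G. scale G T x = 1)"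

definition anisotropic :: "('a, 'b) monoid_scheme \<Rightarrow> 'a topology \<Rightarrow> bool" where
  "anisotropic G T \<longleftrightarrow> (\<forall>x \<in> carrier G. contraction_subgroup G T x = {\<one>\<^bsub>G\<^esub>})"

end

theory Submission
  imports Defs "HOL-Probability.Infinite_Product_Measure"
begin

text \<open>For a compact open subgroup \<open>V\<close> let \<open>I\<^sub>V(g)\<close> be the number of left cosets of \<open>V\<close> in \<open>V g V\<close>; changing
  \<open>V\<close> changes \<open>I\<^sub>V\<close> by at most a bounded factor.  Every \<open>y\<close> has a \<open>V\<close> with
  \<open>V y\<^sup>a V y\<^sup>b V = V y\<^bsup>a+b\<^esup> V\<close>, and for such a \<open>V\<close> the ratio of consecutive values \<open>I\<^sub>V(y\<^sup>k)\<close> is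
  eventually constant and therefore an integer.  So either \<open>I\<^sub>V(y\<^sup>k)\<close> grows at least like \<open>2\<^sup>k\<close>, or two
  consecutive values coincide and then some compact open subgroup \<open>U\<close> satisfies
  \<open>y\<^sup>-\<^sup>1 U y \<subseteq> U\<close>.  Suppose that \<open>y\<close> has exponential growth.  By recurrence on the finite measure
  space \<open>G/H\<close>, some \<open>V y\<^sup>n V\<close> with \<open>n > 0\<close> contains an \<open>h \<in> H\<close>, and \<open>I\<^sub>V(h\<^sup>k) = I\<^sub>V(y\<^bsup>nk\<^esup>)\<close> is exponential
  in \<open>k\<close> with a rate that does not depend on the roots of \<open>h\<close>.  A root \<open>z\<close> of \<open>h = z\<^sup>m\<close> with \<open>m\<close> large
  cannot grow like \<open>2\<^sup>k\<close>, so it has a subgroup \<open>U\<close> as above, and then \<open>I\<^sub>U(h\<^sup>k) = 1\<close> for all \<open>k\<close>, a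
  contradiction.

  A group that is not anisotropic is the semidirect product of \<open>2\<^sup>\<rat>\<close> with \<open>\<rat>\<close>, where \<open>\<rat>\<close> is a cocompact
  divisible lattice and translation by \<open>1\<close> contracts the indicator function of \<open>0\<close>.\<close>

no_notation subset_mset (infix \<open><#\<close> 50)

section \<open>Integer sequences whose consecutive ratios stabilize\<close>

lemma bounded_mono_nat_eventually_const:
  fixes q :: "nat \<Rightarrow> nat"
  assumes "mono q" and "\<And>k. q k \<le> b"
  obtains K where "\<And>k. K \<le> k \<Longrightarrow> q k = q K"
proof -
  have fin: "finite (range q)"
    using assms(2) by (auto intro: finite_subset[of _ "{..b}"])
  then obtain K where K: "q K = Max (range q)"
    using Max_in[OF fin] by fastforce
  have "q k = q K" if "K \<le> k" for k
    using that K fin assms(1) by (metis Max_ge antisym monoD rangeI)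
  then show thesis
    using that by blast
qed

text \<open>If \<open>I (K + m) = I K * (t / q) ^ m\<close> is an integer for every \<open>m\<close>, then so is \<open>t / q\<close>.\<close>

lemma constant_or_exponential_growth:
  fixes I q :: "nat \<Rightarrow> nat"
  assumes eq: "\<And>k. I k * t = I (Suc k) * q k" and q: "mono q"
    and I: "mono I" and I0: "\<And>k. 0 < I k" and t: "0 < t"
  shows "(\<exists>k. I (Suc k) = I k) \<or> (\<exists>K. \<forall>k. 2 ^ k \<le> I (K + k))"
proof -
  \<comment> \<open>Monotonicity of \<open>I\<close> turns the recurrence into a bound on
    \<open>q\<close>, which makes the monotone \<open>q\<close> eventually constant.\<close>
  have "q k \<le> t" for k
  proof -
    have "I k * q k \<le> I k * t"
      using eq I by (simp add: mono_iff_le_Suc)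
    then show ?thesis
      using I0 by simp
  qed
  then obtain K where K: "\<And>k. K \<le> k \<Longrightarrow> q k = q K"
    using bounded_mono_nat_eventually_const[OF q] by blast
  have qpos: "0 < q K"
    using eq[of K] I0[of K] t by (metis mult_is_0 neq0_conv)
  define g where "g = gcd t (q K)"
  obtain t' q' where tq: "t = t' * g" "q K = q' * g" "coprime t' q'"
    using gcd_coprime_exists[of t "q K"] qpos unfolding g_def by auto
  have g: "0 < g" "0 < q'"
    using qpos tq by auto
  have step: "I k * t' = I (Suc k) * q'" if "K \<le> k" for k
    using eq[of k] K[OF that] g tq by auto
  have pow: "I (K + m) * q' ^ m = I K * t' ^ m" for m
  proof (induction m)
    case (Suc m)
    have "I (K + Suc m) * q' ^ Suc m = (I (K + m) * q' ^ m) * t'"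
      using step[of "K + m"] by (simp add: algebra_simps)
    then show ?case
      by (simp add: Suc)
  qed simp
  \<comment> \<open>By coprimality \<open>q' ^ m\<close> divides \<open>I K\<close> for every
    \<open>m\<close>. If \<open>q' \<ge> 2\<close>, the choice \<open>m = I K\<close> is impossible
    because \<open>m < 2 ^ m\<close>.\<close>
  have "q' = 1"
  proof (rule ccontr)
    assume "q' \<noteq> 1"
    then have "2 \<le> q'"
      using g by simp
    define m where "m = I K"
    have "q' ^ m dvd I K * t' ^ m"
      by (metis pow dvd_triv_right)
    then have "q' ^ m dvd I K"
      using tq(3) by (metis coprime_commute coprime_dvd_mult_left_iff coprime_power_left_iff
          coprime_power_right_iff)
    then have "q' ^ m \<le> I K"
      using I0 by (simp add: dvd_imp_le)
    moreover have "2 ^ m \<le> q' ^ m"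
      using \<open>2 \<le> q'\<close> by (simp add: power_mono)
    moreover have "m < 2 ^ m"
      by (rule less_exp)
    ultimately show False
      unfolding m_def by linarith
  qed
  then have pow': "I (K + m) = I K * t' ^ m" for m
    using pow by simp
  show ?thesis
  proof (cases "t' \<le> 1")
    case True
    then have "t' = 1"
      using t tq by (cases t') auto
    then have "I (Suc K) = I K"
      using pow'[of 1] by simp
    then show ?thesis
      by blast
  next
    case False
    have "2 ^ m \<le> I (K + m)" for m
    proof -
      have "1 * 2 ^ m \<le> I K * t' ^ m"
        by (rule mult_mono) (use False I0 in \<open>auto simp: power_mono Suc_le_eq\<close>)
      then show ?thesis
        using pow' by simp
    qed
    then show ?thesis
      by blast
  qed
qed

subsection \<open>Growth of double cosets\<close>

context group
begin

definition double_coset :: "'a set \<Rightarrow> 'a \<Rightarrow> 'a set" where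
  "double_coset V g = (\<Union>u\<in>V. (u \<otimes> g) <# V)"

definition dcosets :: "'a set \<Rightarrow> 'a \<Rightarrow> 'a set set" where
  "dcosets V g = (\<lambda>u. (u \<otimes> g) <# V) ` V"

text \<open>This is the index of V \<inter> g V g^-1 in V, by orbit and stabilizer for the action of
  V on the coset g V.\<close>

definition dindex :: "'a set \<Rightarrow> 'a \<Rightarrow> nat" where
  "dindex V g = card (dcosets V g)"

text \<open>Finiteness excludes the default value 0 of \<open>card\<close> in
  \<open>dindex\<close>.\<close>

definition commensurated :: "'a set \<Rightarrow> bool" where
  "commensurated V \<longleftrightarrow> subgroup V G \<and> (\<forall>g\<in>carrier G. finite (dcosets V g))"

text \<open>In the directed graph on \<open>G/V\<close> with edges \<open>g V \<rightarrow> g v y V\<close>, this says that \<open>V\<close> is transitive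
  on the paths of any given length starting at the vertex \<open>V\<close>.  It is Willis' condition that \<open>V\<close>
  is tidy above for \<open>y\<close>.\<close>

definition path_transitive :: "'a set \<Rightarrow> 'a \<Rightarrow> bool" where
  "path_transitive V y \<longleftrightarrow> (\<forall>a. \<forall>v\<in>V. y [^] (a::nat) \<otimes> v \<otimes> y \<in> double_coset V (y [^] Suc a))"

lemma mem_double_coset_iff:
  "x \<in> double_coset V g \<longleftrightarrow> (\<exists>u\<in>V. \<exists>v\<in>V. x = u \<otimes> g \<otimes> v)"
  by (auto simp: double_coset_def l_coset_def)

lemma lcos_eq_iff:
  assumes "subgroup V G" "a \<in> carrier G" "b \<in> carrier G"
  shows "a <# V = b <# V \<longleftrightarrow> b \<in> a <# V"
  using assms by (metis lcos_self l_repr_independence subgroup.subset)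

lemma lcos_absorb:
  assumes "subgroup V G" "a \<in> carrier G" "v \<in> V"
  shows "(a \<otimes> v) <# V = a <# V"
proof -
  have "v \<in> carrier G"
    using assms by (meson subgroup.mem_carrier)
  moreover have "a \<otimes> v \<in> a <# V"
    using assms by (auto simp: l_coset_def)
  ultimately show ?thesis
    using assms lcos_eq_iff by (metis m_closed)
qed

lemma inj_on_lcos: "a \<in> carrier G \<Longrightarrow> inj_on (\<lambda>A. a <# A) (Pow (carrier G))"
  by (rule inj_on_inverseI[where g = "\<lambda>A. inv a <# A"]) (simp add: lcos_m_assoc lcos_mult_one)

lemma dcosets_iff:
  assumes "subgroup V G" "g \<in> carrier G" "a \<in> carrier G"
  shows "a <# V \<in> dcosets V g \<longleftrightarrow> a \<in> double_coset V g"
proof -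
  have "a <# V = (u \<otimes> g) <# V \<longleftrightarrow> a \<in> (u \<otimes> g) <# V" if "u \<in> V" for u
    using assms that lcos_eq_iff[of V "u \<otimes> g" a] by (metis m_closed subgroup.mem_carrier)
  then show ?thesis
    by (auto simp: dcosets_def double_coset_def)
qed

text \<open>The right factor of \<open>h\<close> is absorbed by the coset, and right translation by
  the left factor only permutes \<open>V\<close>.\<close>

lemma dcosets_cong:
  assumes V: "subgroup V G" and "g \<in> carrier G" "h \<in> double_coset V g"
  shows "dcosets V h = dcosets V g"
proof -
  interpret V: subgroup V G by fact
  obtain u v where uv: "u \<in> V" "v \<in> V" and h: "h = u \<otimes> g \<otimes> v"
    using assms mem_double_coset_iff by blast
  have eq: "(w \<otimes> h) <# V = ((w \<otimes> u) \<otimes> g) <# V" if "w \<in> V" for w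
    using that uv assms(2) V lcos_absorb[of V "w \<otimes> u \<otimes> g" v]
    by (simp add: h m_assoc V.mem_carrier)
  have "(\<lambda>w. w \<otimes> u) ` V = V"
  proof
    show "V \<subseteq> (\<lambda>w. w \<otimes> u) ` V"
    proof
      fix w assume "w \<in> V"
      then have "w \<otimes> inv u \<in> V" "w = (w \<otimes> inv u) \<otimes> u"
        using uv by (auto simp: m_assoc V.mem_carrier)
      then show "w \<in> (\<lambda>w. w \<otimes> u) ` V"
        by blast
    qed
  qed (use uv in auto)
  then have "(\<lambda>w. (w \<otimes> g) <# V) ` V = (\<lambda>w. (w \<otimes> g) <# V) ` (\<lambda>w. w \<otimes> u) ` V"
    by simp
  then show ?thesis
    using eq by (simp add: dcosets_def image_image)
qed

lemma dindex_pos: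
  assumes "commensurated V" "g \<in> carrier G"
  shows "0 < dindex V g"
proof -
  have "V \<noteq> {}"
    using assms by (metis commensurated_def empty_iff subgroup.one_closed)
  then show ?thesis
    using assms by (auto simp: dindex_def commensurated_def card_gt_0_iff dcosets_def)
qed

text \<open>The definition is the case \<open>b = 1\<close>. Each further factor \<open>y\<close> is
  absorbed by applying the definition to the element of \<open>V\<close> that the previous step
  leaves in front of it.\<close>

lemma path_transitiveD:
  assumes V: "subgroup V G" and y: "y \<in> carrier G" and p: "path_transitive V y" and v: "v \<in> V"
  shows "y [^] (a::nat) \<otimes> v \<otimes> y [^] (b::nat) \<in> double_coset V (y [^] (a + b))"
proof (induction b)
  interpret V: subgroup V G by fact
  case 0
  then show ?case
    unfolding mem_double_coset_iff
    using v y V.mem_carrier by (intro bexI[of _ \<one>] bexI[of _ v]) auto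
next
  interpret V: subgroup V G by fact
  case (Suc b)
  then obtain u w where uw: "u \<in> V" "w \<in> V" "y [^] a \<otimes> v \<otimes> y [^] b = u \<otimes> y [^] (a + b) \<otimes> w"
    by (auto simp: mem_double_coset_iff)
  obtain u' w' where uw': "u' \<in> V" "w' \<in> V"
    "y [^] (a + b) \<otimes> w \<otimes> y = u' \<otimes> y [^] Suc (a + b) \<otimes> w'"
    using p uw(2) unfolding path_transitive_def mem_double_coset_iff by blast
  have "y [^] a \<otimes> v \<otimes> y [^] Suc b = (y [^] a \<otimes> v \<otimes> y [^] b) \<otimes> y"
    using v y V.mem_carrier by (simp add: m_assoc)
  also have "\<dots> = u \<otimes> (y [^] (a + b) \<otimes> w \<otimes> y)"
    using uw y V.mem_carrier by (simp add: m_assoc)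
  also have "\<dots> = (u \<otimes> u') \<otimes> y [^] Suc (a + b) \<otimes> w'"
    unfolding uw'(3) using uw uw' y V.mem_carrier by (simp add: m_assoc)
  finally show ?case
    using uw uw' by (auto simp: mem_double_coset_iff)
qed

text \<open>Products of the double cosets of powers of \<open>y\<close> stay in a single double
  coset, so \<open>h\<close> grows exactly like \<open>y [^] n\<close>. This transfers the growth of
  \<open>y\<close> to a lattice element.\<close>

lemma path_transitive_double_coset_pow:
  assumes V: "subgroup V G" and y: "y \<in> carrier G" and p: "path_transitive V y"
    and h: "h \<in> double_coset V (y [^] (n::nat))"
  shows "h [^] (k::nat) \<in> double_coset V (y [^] (n * k))"
proof (induction k)
  interpret V: subgroup V G by fact
  case 0
  show ?case
    by (auto simp: mem_double_coset_iff intro!: bexI[of _ \<one>])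
next
  interpret V: subgroup V G by fact
  case (Suc k)
  obtain u v where uv: "u \<in> V" "v \<in> V" "h [^] k = u \<otimes> y [^] (n * k) \<otimes> v"
    using Suc by (auto simp: mem_double_coset_iff)
  obtain u' v' where uv': "u' \<in> V" "v' \<in> V" "h = u' \<otimes> y [^] n \<otimes> v'"
    using h by (auto simp: mem_double_coset_iff)
  obtain a b where ab: "a \<in> V" "b \<in> V"
    "y [^] (n * k) \<otimes> (v \<otimes> u') \<otimes> y [^] n = a \<otimes> y [^] (n * k + n) \<otimes> b"
    using path_transitiveD[OF V y p, of "v \<otimes> u'" "n * k" n] uv uv'
    by (auto simp: mem_double_coset_iff)
  have "h [^] Suc k = (u \<otimes> y [^] (n * k) \<otimes> v) \<otimes> (u' \<otimes> y [^] n \<otimes> v')"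
    using uv(3) uv'(3) by simp
  also have "\<dots> = u \<otimes> (y [^] (n * k) \<otimes> (v \<otimes> u') \<otimes> y [^] n) \<otimes> v'"
    using uv(1,2) uv'(1,2) y V.mem_carrier by (simp add: m_assoc)
  also have "\<dots> = (u \<otimes> a) \<otimes> y [^] (n * Suc k) \<otimes> (b \<otimes> v')"
    unfolding ab(3) using uv(1,2) uv'(1,2) ab(1,2) y V.mem_carrier by (simp add: m_assoc add.commute)
  finally show ?case
    using uv uv' ab by (auto simp: mem_double_coset_iff)
qed


section \<open>Path-transitive subgroups as finite intersections of the conjugates y^-i V
  y^i\<close>

definition iterated_core :: "'a set \<Rightarrow> 'a \<Rightarrow> nat \<Rightarrow> 'a set" where
  "iterated_core V y n = {g \<in> carrier G. \<forall>i\<le>n. y [^] i \<otimes> g \<otimes> inv (y [^] i) \<in> V}"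

lemma conj_mult:
  assumes "a \<in> carrier G" "g \<in> carrier G" "h \<in> carrier G"
  shows "a \<otimes> (g \<otimes> h) \<otimes> inv a = (a \<otimes> g \<otimes> inv a) \<otimes> (a \<otimes> h \<otimes> inv a)"
proof -
  have "(a \<otimes> g \<otimes> inv a) \<otimes> (a \<otimes> h \<otimes> inv a) = a \<otimes> g \<otimes> (inv a \<otimes> a) \<otimes> h \<otimes> inv a"
    using assms by (simp only: m_assoc m_closed inv_closed)
  then show ?thesis
    using assms by (simp add: m_assoc)
qed

lemma conj_inv:
  assumes "a \<in> carrier G" "g \<in> carrier G"
  shows "a \<otimes> inv g \<otimes> inv a = inv (a \<otimes> g \<otimes> inv a)"
  using assms by (simp add: inv_mult_group m_assoc)

lemma conj_conj:
  assumes "a \<in> carrier G" "b \<in> carrier G" "g \<in> carrier G"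
  shows "a \<otimes> (b \<otimes> g \<otimes> inv b) \<otimes> inv a = (a \<otimes> b) \<otimes> g \<otimes> inv (a \<otimes> b)"
  using assms by (simp add: inv_mult_group m_assoc)

lemma subgroup_iterated_core:
  assumes V: "subgroup V G" and y: "y \<in> carrier G"
  shows "subgroup (iterated_core V y n) G"
proof -
  interpret V: subgroup V G by fact
  show ?thesis
    by (rule subgroupI)
      (use y in \<open>auto simp: iterated_core_def conj_mult conj_inv intro!: exI[of _ \<one>]\<close>)
qed

lemma iterated_core_antimono: "m \<le> n \<Longrightarrow> iterated_core V y n \<subseteq> iterated_core V y m"
  by (auto simp: iterated_core_def)

lemma iterated_core_subset: "y \<in> carrier G \<Longrightarrow> iterated_core V y n \<subseteq> V"
  by (auto simp: iterated_core_def dest!: spec[of _ 0])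

text \<open>The sets \<open>C n\<close> of cosets v y V with \<open>v\<close> in the n-th core
  decrease inside a finite set, hence stabilize at some \<open>N\<close>. An element of the core
  \<open>N\<close> can then be replaced, modulo the coset, by one of the much smaller core
  \<open>N + a\<close>, which stays in the core \<open>N\<close> after conjugation by
  \<open>y [^] a\<close>.\<close>

lemma ex_path_transitive_iterated_core:
  assumes V: "subgroup V G" and y: "y \<in> carrier G" and fin: "finite (dcosets V y)"
  shows "\<exists>N. path_transitive (iterated_core V y N) y"
proof -
  interpret V: subgroup V G by fact
  define W where "W = iterated_core V y"
  have W: "subgroup (W n) G" for n
    unfolding W_def using V y by (rule subgroup_iterated_core)
  have W_car: "w \<in> carrier G" if "w \<in> W n" for w n
    using W that by (meson subgroup.mem_carrier)
  define C where "C n = (\<lambda>v. (v \<otimes> y) <# V) ` W n" for n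
  have C: "C n \<subseteq> C m" if "m \<le> n" for m n
    unfolding C_def W_def using iterated_core_antimono[OF that] by blast
  have "C 0 \<subseteq> dcosets V y"
    unfolding C_def W_def dcosets_def using iterated_core_subset[OF y] by blast
  then have finC: "finite (C n)" for n
    using C[of 0 n] fin finite_subset by (metis le0)
  obtain N where N: "\<And>n. card (C N) \<le> card (C n)"
    using ex_has_least_nat[of "\<lambda>_. True" undefined "\<lambda>n. card (C n)"] by blast
  have CN: "C n = C N" if "N \<le> n" for n
    using card_seteq[OF finC C[OF that] N] .
  have "y [^] a \<otimes> w \<otimes> y \<in> double_coset (W N) (y [^] Suc a)" if w: "w \<in> W N" for a w
  proof -
    have "(w \<otimes> y) <# V \<in> C (N + a)"
      using CN[of "N + a"] w by (auto simp: C_def)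
    then obtain v where v: "v \<in> W (N + a)" and vw: "(w \<otimes> y) <# V = (v \<otimes> y) <# V"
      unfolding C_def by blast
    have car: "v \<in> carrier G" "w \<in> carrier G"
      using v w W_car by auto
    define z where "z = inv (v \<otimes> y) \<otimes> (w \<otimes> y)"
    have z: "z \<in> carrier G"
      using car y by (simp add: z_def)
    have zV: "z \<in> V"
      using vw car y V lcos_eq_iff[of V "v \<otimes> y" "w \<otimes> y"] V.lcos_module_imp[OF group_axioms]
      unfolding z_def by (metis m_closed)
    have vwN: "inv v \<otimes> w \<in> W N"
      using v w W iterated_core_antimono[of N "N + a" V y] unfolding W_def
      by (meson le_add1 subgroup.m_closed subgroup.m_inv_closed subsetD)
    \<comment> \<open>Since y z y^-1 = v^-1 w lies in \<open>W N\<close>, all conjugates with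
      \<open>i > 0\<close> are conjugates of v^-1 w with exponent \<open>i - 1\<close>; the case
      \<open>i = 0\<close> is the equality of cosets.\<close>
    have "y [^] i \<otimes> z \<otimes> inv (y [^] i) \<in> V" if "i \<le> N" for i
    proof (cases i)
      case 0
      then show ?thesis
        using zV z by simp
    next
      case (Suc j)
      have "y \<otimes> z \<otimes> inv y = inv v \<otimes> w"
        using car y by (simp add: z_def inv_mult_group m_assoc flip: m_assoc[of y "inv y"])
      then have "y [^] i \<otimes> z \<otimes> inv (y [^] i) = y [^] j \<otimes> (inv v \<otimes> w) \<otimes> inv (y [^] j)"
        using Suc y z by (simp add: conj_conj[symmetric])
      then show ?thesis
        using vwN that Suc by (simp add: W_def iterated_core_def)
    qed
    then have zW: "z \<in> W N"
      using z by (simp add: W_def iterated_core_def)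
    \<comment> \<open>Conjugation by \<open>y [^] a\<close> uses up \<open>a\<close> of the
      \<open>N + a\<close> conditions on \<open>v\<close>, leaving those for \<open>W N\<close>.
      Then y^a w y = y^a v y z = u y^(a+1) z.\<close>
    define u where "u = y [^] a \<otimes> v \<otimes> inv (y [^] a)"
    have u: "u \<in> carrier G"
      using car y by (simp add: u_def)
    have "y [^] i \<otimes> u \<otimes> inv (y [^] i) \<in> V" if "i \<le> N" for i
    proof -
      have "y [^] i \<otimes> u \<otimes> inv (y [^] i) = y [^] (i + a) \<otimes> v \<otimes> inv (y [^] (i + a))"
        using car y by (simp add: u_def conj_conj nat_pow_mult)
      then show ?thesis
        using v that by (simp add: W_def iterated_core_def)
    qed
    then have uW: "u \<in> W N"
      using u by (simp add: W_def iterated_core_def)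
    have "v \<otimes> y \<otimes> z = w \<otimes> y"
      using car y by (simp add: z_def flip: m_assoc)
    moreover have "u \<otimes> y [^] Suc a \<otimes> z = y [^] a \<otimes> (v \<otimes> y \<otimes> z)"
      using car y z by (simp add: u_def m_assoc) (simp flip: m_assoc[of "inv _"])
    ultimately have "y [^] a \<otimes> w \<otimes> y = u \<otimes> y [^] Suc a \<otimes> z"
      using car y by (simp add: m_assoc)
    then show ?thesis
      using uW zW by (auto simp: mem_double_coset_iff)
  qed
  then show ?thesis
    unfolding path_transitive_def W_def by blast
qed

section \<open>Counting edges between successive levels of the coset graph\<close>

definition out_neighbours :: "'a set \<Rightarrow> 'a \<Rightarrow> 'a set \<Rightarrow> 'a set set" where
  "out_neighbours V y A = (\<lambda>a. (a \<otimes> y) <# V) ` A"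

text \<open>Left translations are automorphisms of the graph, because its edges are defined by right
  multiplication.\<close>

lemma translate_out_neighbours:
  assumes "V \<subseteq> carrier G" "y \<in> carrier G" "g \<in> carrier G" "A \<subseteq> carrier G"
  shows "out_neighbours V y (g <# A) = (\<lambda>B. g <# B) ` out_neighbours V y A"
proof -
  have "g <# A = (\<lambda>a. g \<otimes> a) ` A"
    by (auto simp: l_coset_def)
  moreover have "(g \<otimes> a \<otimes> y) <# V = g <# ((a \<otimes> y) <# V)" if "a \<in> A" for a
  proof -
    have "a \<in> carrier G"
      using that assms by blast
    then show ?thesis
      using assms by (simp add: m_assoc lcos_m_assoc)
  qed
  ultimately show ?thesis
    unfolding out_neighbours_def by (simp add: image_image)
qed

lemma dcosets_subset_Pow:
  assumes "subgroup V G" "g \<in> carrier G"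
  shows "dcosets V g \<subseteq> Pow (carrier G)"
proof
  interpret V: subgroup V G by fact
  fix A assume "A \<in> dcosets V g"
  then obtain u where "u \<in> V" "A = (u \<otimes> g) <# V"
    by (auto simp: dcosets_def)
  then show "A \<in> Pow (carrier G)"
    using assms l_coset_subset_G[OF V.subset, of "u \<otimes> g"] V.mem_carrier by simp
qed

lemma translate_dcosets:
  assumes V: "subgroup V G" and g: "g \<in> carrier G" and u: "u \<in> V"
  shows "(\<lambda>A. u <# A) ` dcosets V g = dcosets V g"
proof
  interpret V: subgroup V G by fact
  have sub: "(\<lambda>A. u <# A) ` dcosets V g \<subseteq> dcosets V g" if u: "u \<in> V" for u
  proof
    fix B assume "B \<in> (\<lambda>A. u <# A) ` dcosets V g"
    then obtain v where v: "v \<in> V" "B = u <# ((v \<otimes> g) <# V)"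
      by (auto simp: dcosets_def)
    then have "B = ((u \<otimes> v) \<otimes> g) <# V"
      using u g V.mem_carrier by (simp add: lcos_m_assoc V.subset m_assoc)
    then show "B \<in> dcosets V g"
      using u v by (auto simp: dcosets_def)
  qed
  then show "(\<lambda>A. u <# A) ` dcosets V g \<subseteq> dcosets V g"
    using u .
  show "dcosets V g \<subseteq> (\<lambda>A. u <# A) ` dcosets V g"
  proof
    fix A assume A: "A \<in> dcosets V g"
    then have "A \<subseteq> carrier G"
      using dcosets_subset_Pow[OF V g] by blast
    then have "A = u <# (inv u <# A)"
      using u V.mem_carrier by (simp add: lcos_m_assoc lcos_mult_one)
    moreover have "inv u <# A \<in> dcosets V g"
      using sub[of "inv u"] u A by blast
    ultimately show "A \<in> (\<lambda>A. u <# A) ` dcosets V g"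
      by blast
  qed
qed

text \<open>Call \<open>dcosets V (y [^] k)\<close> level \<open>k\<close>. Translation by
  \<open>y\<close> embeds each level in the next; this is the source of monotonicity in the growth
  argument.\<close>

lemma translate_dcosets_pow:
  assumes V: "subgroup V G" and y: "y \<in> carrier G" and p: "path_transitive V y"
  shows "(\<lambda>A. y <# A) ` dcosets V (y [^] (k::nat)) \<subseteq> dcosets V (y [^] Suc k)"
proof
  interpret V: subgroup V G by fact
  fix B assume "B \<in> (\<lambda>A. y <# A) ` dcosets V (y [^] k)"
  then obtain v where v: "v \<in> V" "B = y <# ((v \<otimes> y [^] k) <# V)"
    by (auto simp: dcosets_def)
  then have "B = (y \<otimes> v \<otimes> y [^] k) <# V"
    using y V.mem_carrier by (simp add: lcos_m_assoc V.subset m_assoc)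
  moreover have "y \<otimes> v \<otimes> y [^] k \<in> double_coset V (y [^] Suc k)"
    using path_transitiveD[OF V y p v(1), of 1 k] y by simp
  ultimately show "B \<in> dcosets V (y [^] Suc k)"
    using dcosets_iff[OF V, of "y [^] Suc k" "y \<otimes> v \<otimes> y [^] k"] y v V.mem_carrier by simp
qed

text \<open>Path transitivity forces every edge leaving level \<open>k\<close> to end in level
  \<open>Suc k\<close>.\<close>

lemma out_neighbours_dcosets:
  assumes V: "subgroup V G" and y: "y \<in> carrier G" and p: "path_transitive V y"
    and A: "A \<in> dcosets V (y [^] (k::nat))"
  shows "out_neighbours V y A \<subseteq> dcosets V (y [^] Suc k)"
proof
  interpret V: subgroup V G by fact
  fix B assume "B \<in> out_neighbours V y A"
  then obtain u w where uw: "u \<in> V" "w \<in> V" "B = (u \<otimes> y [^] k \<otimes> w \<otimes> y) <# V"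
    using A by (auto simp: out_neighbours_def dcosets_def l_coset_def)
  obtain u' w' where uw': "u' \<in> V" "w' \<in> V"
    "y [^] k \<otimes> w \<otimes> y = u' \<otimes> y [^] Suc k \<otimes> w'"
    using p uw(2) unfolding path_transitive_def mem_double_coset_iff by blast
  have "u \<otimes> y [^] k \<otimes> w \<otimes> y = u \<otimes> (y [^] k \<otimes> w \<otimes> y)"
    using uw(1,2) y V.mem_carrier by (simp add: m_assoc)
  also have "\<dots> = (u \<otimes> u') \<otimes> y [^] Suc k \<otimes> w'"
    unfolding uw'(3) using uw uw' y V.mem_carrier by (simp add: m_assoc)
  finally have "u \<otimes> y [^] k \<otimes> w \<otimes> y \<in> double_coset V (y [^] Suc k)"
    using uw uw' by (auto simp: mem_double_coset_iff)
  then show "B \<in> dcosets V (y [^] Suc k)"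
    using dcosets_iff[OF V, of "y [^] Suc k" "u \<otimes> y [^] k \<otimes> w \<otimes> y"] y uw V.mem_carrier by simp
qed

lemma Union_out_neighbours_dcosets:
  assumes V: "subgroup V G" and y: "y \<in> carrier G" and p: "path_transitive V y"
  shows "\<Union> (out_neighbours V y ` dcosets V (y [^] (k::nat))) = dcosets V (y [^] Suc k)"
proof
  interpret V: subgroup V G by fact
  show "\<Union> (out_neighbours V y ` dcosets V (y [^] k)) \<subseteq> dcosets V (y [^] Suc k)"
    using out_neighbours_dcosets[OF V y p] by blast
  show "dcosets V (y [^] Suc k) \<subseteq> \<Union> (out_neighbours V y ` dcosets V (y [^] k))"
  proof
    fix B assume "B \<in> dcosets V (y [^] Suc k)"
    then obtain u where u: "u \<in> V" "B = (u \<otimes> y [^] Suc k) <# V"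
      by (auto simp: dcosets_def)
    then have "B = (u \<otimes> y [^] k \<otimes> y) <# V"
      using y V.mem_carrier by (simp add: m_assoc)
    moreover have "u \<otimes> y [^] k \<in> (u \<otimes> y [^] k) <# V"
      using u y V.mem_carrier V lcos_self by simp
    ultimately have "B \<in> out_neighbours V y ((u \<otimes> y [^] k) <# V)"
      by (auto simp: out_neighbours_def)
    then show "B \<in> \<Union> (out_neighbours V y ` dcosets V (y [^] k))"
      using u by (auto simp: dcosets_def)
  qed
qed

text \<open>Every vertex has the out-degree of the base vertex \<open>V\<close>, by
  translation.\<close>

lemma card_out_neighbours:
  assumes V: "subgroup V G" and y: "y \<in> carrier G" and a: "a \<in> carrier G"
  shows "card (out_neighbours V y (a <# V)) = dindex V y"
proof -
  interpret V: subgroup V G by fact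
  have "out_neighbours V y (a <# V) = (\<lambda>B. a <# B) ` dcosets V y"
    using translate_out_neighbours[OF V.subset y a V.subset]
    by (simp add: dcosets_def out_neighbours_def)
  moreover have "inj_on (\<lambda>B. a <# B) (dcosets V y)"
    by (rule inj_on_subset[OF inj_on_lcos[OF a] dcosets_subset_Pow[OF V y]])
  ultimately show ?thesis
    by (simp add: dindex_def card_image)
qed


text \<open>Edges from level \<open>k\<close> to the next are counted twice: by the constant
  out-degree \<open>dindex V y\<close>, and by an in-degree \<open>q k\<close> that is constant on
  the level. This yields the recurrence of \<open>constant_or_exponential_growth\<close>.\<close>

lemma dindex_growth:
  assumes V: "commensurated V" and y: "y \<in> carrier G" and p: "path_transitive V y"
  shows "(\<exists>k. dindex V (y [^] Suc k) = dindex V (y [^] (k::nat))) \<or>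
    (\<exists>K::nat. \<forall>k. 2 ^ k \<le> dindex V (y [^] (K + k)))"
proof -
  interpret V: subgroup V G
    using V by (simp add: commensurated_def)
  have V': "subgroup V G" ..
  define S where "S k = dcosets V (y [^] (k::nat))" for k
  have fin: "finite (S k)" for k
    using V y by (simp add: S_def commensurated_def)
  have cardS: "card (S k) = dindex V (y [^] k)" for k
    by (simp add: S_def dindex_def)
  have SP: "S k \<subseteq> Pow (carrier G)" for k
    unfolding S_def using dcosets_subset_Pow[OF V'] y by simp
  define q where "q k = card {A \<in> S k. y [^] Suc k <# V \<in> out_neighbours V y A}" for k
  have inS: "y [^] k <# V \<in> S k" for k
    unfolding S_def dcosets_def using y by (intro image_eqI[of _ _ \<one>]) auto
  have yS: "(\<lambda>A. y <# A) ` S k \<subseteq> S (Suc k)" for k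
    unfolding S_def by (rule translate_dcosets_pow[OF V' y p])
  have inj: "inj_on (\<lambda>A. a <# A) (S k)" if "a \<in> carrier G" for a k
    by (rule inj_on_subset[OF inj_on_lcos[OF that] SP])
  \<comment> \<open>\<open>V\<close> is transitive on level \<open>Suc k\<close> and acts on level
    \<open>k\<close> by graph automorphisms, so every vertex has the in-degree of the vertex used to
    define \<open>q k\<close>.\<close>
  have count_in: "card {A \<in> S k. B \<in> out_neighbours V y A} = q k" if BS: "B \<in> S (Suc k)" for B k
  proof -
    obtain u where u: "u \<in> V" and B: "B = (u \<otimes> y [^] Suc k) <# V"
      using BS unfolding S_def dcosets_def by blast
    have uc: "u \<in> carrier G"
      using u by (rule V.mem_carrier)
    have B': "B = u <# (y [^] Suc k <# V)"
      using B uc y by (simp add: lcos_m_assoc V.subset)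
    have iff: "u <# C \<in> out_neighbours V y (u <# A) \<longleftrightarrow> C \<in> out_neighbours V y A"
      if A: "A \<in> S k" and C: "C \<in> S (Suc k)" for A C
    proof -
      have "out_neighbours V y A \<subseteq> S (Suc k)"
        using out_neighbours_dcosets[OF V' y p] A by (simp add: S_def)
      moreover have "out_neighbours V y (u <# A) = (\<lambda>B. u <# B) ` out_neighbours V y A"
        using A SP by (intro translate_out_neighbours V.subset y uc) blast
      ultimately show ?thesis
        using inj_on_image_mem_iff[OF inj[OF uc, of "Suc k"] C] by simp
    qed
    have "{A \<in> S k. B \<in> out_neighbours V y A} =
        (\<lambda>A. u <# A) ` {A \<in> S k. y [^] Suc k <# V \<in> out_neighbours V y A}"
    proof -
      have uS: "(\<lambda>A. u <# A) ` S k = S k"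
        unfolding S_def by (rule translate_dcosets[OF V' _ u]) (simp add: y)
      have "{A \<in> f ` X. P A} = f ` {A \<in> X. P (f A)}" for f X and P :: "'a set \<Rightarrow> bool"
        by blast
      from this[of "\<lambda>A. u <# A" "S k" "\<lambda>A. B \<in> out_neighbours V y A"]
      have "{A \<in> S k. B \<in> out_neighbours V y A} =
          (\<lambda>A. u <# A) ` {A \<in> S k. B \<in> out_neighbours V y (u <# A)}"
        unfolding uS .
      also have "{A \<in> S k. B \<in> out_neighbours V y (u <# A)} =
          {A \<in> S k. y [^] Suc k <# V \<in> out_neighbours V y A}"
        using iff[OF _ inS[of "Suc k"]] B' by auto
      finally show ?thesis .
    qed
    then show ?thesis
      using inj_on_subset[OF inj[OF uc, of k]] unfolding q_def by (simp add: card_image)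
  qed
  have eq: "card (S k) * dindex V y = card (S (Suc k)) * q k" for k
  proof -
    have out: "card {B \<in> S (Suc k). B \<in> out_neighbours V y A} = dindex V y" if A: "A \<in> S k" for A
    proof -
      have "{B \<in> S (Suc k). B \<in> out_neighbours V y A} = out_neighbours V y A"
        using out_neighbours_dcosets[OF V' y p] A unfolding S_def by blast
      moreover obtain u where u: "u \<in> V" "A = (u \<otimes> y [^] k) <# V"
        using A by (auto simp: S_def dcosets_def)
      ultimately show ?thesis
        using card_out_neighbours[OF V' y, of "u \<otimes> y [^] k"] y V.mem_carrier by simp
    qed
    have "(\<Sum>A\<in>S k. card {B \<in> S (Suc k). B \<in> out_neighbours V y A}) = q k * card (S (Suc k))"
      by (rule sum_multicount[OF fin fin]) (use count_in in auto)
    then show ?thesis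
      using out by (simp add: mult.commute)
  qed
  \<comment> \<open>Translation by \<open>y\<close> carries the in-neighbours counted by
    \<open>q k\<close> injectively to ones counted by \<open>q (Suc k)\<close>.\<close>
  have "q k \<le> q (Suc k)" for k
  proof -
    have "(\<lambda>A. y <# A) ` {A \<in> S k. y [^] Suc k <# V \<in> out_neighbours V y A} \<subseteq>
        {A \<in> S (Suc k). y [^] Suc (Suc k) <# V \<in> out_neighbours V y A}"
    proof safe
      fix A assume A: "A \<in> S k" "y [^] Suc k <# V \<in> out_neighbours V y A"
      then show "y <# A \<in> S (Suc k)"
        using yS by blast
      have "y \<otimes> y [^] Suc k = y [^] Suc (Suc k)"
        by (metis nat_pow_Suc2 y)
      then have "y [^] Suc (Suc k) <# V = y <# (y [^] Suc k <# V)"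
        using y by (metis lcos_m_assoc V.subset nat_pow_closed)
      moreover have "out_neighbours V y (y <# A) = (\<lambda>B. y <# B) ` out_neighbours V y A"
        using A SP by (intro translate_out_neighbours V.subset y) blast
      ultimately show "y [^] Suc (Suc k) <# V \<in> out_neighbours V y (y <# A)"
        using A by simp
    qed
    then have "card ((\<lambda>A. y <# A) ` {A \<in> S k. y [^] Suc k <# V \<in> out_neighbours V y A}) \<le> q (Suc k)"
      unfolding q_def by (intro card_mono) (auto simp: fin)
    then show ?thesis
      using inj_on_subset[OF inj[OF y, of k]] unfolding q_def by (simp add: card_image)
  qed
  then have "mono q"
    by (simp add: mono_iff_le_Suc)
  moreover have "card (S k) \<le> card (S (Suc k))" for k
    using card_mono[OF fin yS[of k]] inj[OF y, of k] by (simp add: card_image)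
  then have "mono (\<lambda>k. card (S k))"
    by (simp add: mono_iff_le_Suc)
  moreover have "0 < card (S k)" for k
    using fin inS by (auto simp: card_gt_0_iff)
  moreover have "0 < dindex V y"
    using dindex_pos[OF V y] .
  ultimately show ?thesis
    using constant_or_exponential_growth[of "\<lambda>k. card (S k)" "dindex V y" q] eq
    unfolding cardS by blast
qed

text \<open>If the growth stops, then \<open>y V y\<^sup>k V = V y\<^bsup>k+1\<^esup> V\<close> by counting cosets, and \<open>U\<close> can be taken to be the
  stabilizer of \<open>V y\<^sup>k V\<close> under left translation: it also stabilizes \<open>V y\<^sup>k V y V = V y\<^bsup>k+1\<^esup> V\<close>.\<close>

lemma ex_subgroup_in_conj:
  assumes V: "commensurated V" and y: "y \<in> carrier G" and p: "path_transitive V y"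
    and eq: "dindex V (y [^] Suc k) = dindex V (y [^] (k::nat))"
  shows "\<exists>U. subgroup U G \<and> V \<subseteq> U \<and>
      (\<forall>g\<in>U. \<exists>u\<in>V. \<exists>v\<in>V. g = u \<otimes> y [^] k \<otimes> v \<otimes> inv (y [^] k)) \<and>
      (\<forall>g\<in>U. inv y \<otimes> g \<otimes> y \<in> U)"
proof -
  interpret V: subgroup V G
    using V by (simp add: commensurated_def)
  have V': "subgroup V G" ..
  define S where "S k = dcosets V (y [^] (k::nat))" for k
  have fin: "finite (S k)" for k
    using V y by (simp add: S_def commensurated_def)
  have SP: "S k \<subseteq> Pow (carrier G)" for k
    unfolding S_def using dcosets_subset_Pow[OF V'] y by simp
  have inj: "inj_on (\<lambda>A. a <# A) (S k)" if "a \<in> carrier G" for a k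
    by (rule inj_on_subset[OF inj_on_lcos[OF that] SP])
  have comp: "(\<lambda>A. a <# A) ` (\<lambda>A. b <# A) ` S k = (\<lambda>A. (a \<otimes> b) <# A) ` S k"
    if "a \<in> carrier G" "b \<in> carrier G" for a b k
    unfolding image_image using SP that by (intro image_cong refl lcos_m_assoc) blast+
  have one: "(\<lambda>A. \<one> <# A) ` S k = S k" for k
  proof -
    have "(\<lambda>A. \<one> <# A) ` S k = (\<lambda>A. A) ` S k"
      using SP by (intro image_cong refl lcos_mult_one) blast
    then show ?thesis
      by simp
  qed
  \<comment> \<open>The embedding of level \<open>k\<close> in level \<open>Suc k\<close> is onto
    because both are finite of the same size.\<close>
  have yS: "(\<lambda>A. y <# A) ` S k = S (Suc k)"
  proof (rule card_subset_eq[OF fin])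
    show "(\<lambda>A. y <# A) ` S k \<subseteq> S (Suc k)"
      unfolding S_def by (rule translate_dcosets_pow[OF V' y p])
    show "card ((\<lambda>A. y <# A) ` S k) = card (S (Suc k))"
      unfolding card_image[OF inj[OF y]] using eq by (simp add: S_def dindex_def)
  qed
  define U where "U = {g \<in> carrier G. (\<lambda>A. g <# A) ` S k = S k}"
  have "subgroup U G"
  proof (rule subgroupI)
    show "U \<noteq> {}"
      using one by (auto simp: U_def)
    show "inv g \<in> U" if "g \<in> U" for g
    proof -
      have g: "g \<in> carrier G" "(\<lambda>A. g <# A) ` S k = S k"
        using that by (auto simp: U_def)
      have "(\<lambda>A. inv g <# A) ` S k = (\<lambda>A. inv g <# A) ` (\<lambda>A. g <# A) ` S k"
        using g by simp
      also have "\<dots> = S k"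
        using g one by (subst comp) auto
      finally show ?thesis
        using g by (simp add: U_def)
    qed
    show "g \<otimes> h \<in> U" if "g \<in> U" "h \<in> U" for g h
      using that comp[of g h k] by (auto simp: U_def)
  qed (auto simp: U_def)
  \<comment> \<open>This inclusion will make \<open>U\<close> open; the next one, into V y^k V y^-k,
    will make it compact.\<close>
  moreover have "V \<subseteq> U"
    using translate_dcosets[OF V', of "y [^] k"] y V.mem_carrier by (auto simp: U_def S_def)
  moreover have "\<exists>u\<in>V. \<exists>v\<in>V. g = u \<otimes> y [^] k \<otimes> v \<otimes> inv (y [^] k)" if "g \<in> U" for g
  proof -
    have g: "g \<in> carrier G" "(\<lambda>A. g <# A) ` S k = S k"
      using that by (auto simp: U_def)
    have "y [^] k <# V \<in> S k"
      unfolding S_def dcosets_def using y by (intro image_eqI[of _ _ \<one>]) auto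
    then have "g <# (y [^] k <# V) \<in> S k"
      using g by blast
    then have "(g \<otimes> y [^] k) <# V \<in> S k"
      using g y by (simp add: lcos_m_assoc V.subset)
    then have "g \<otimes> y [^] k \<in> double_coset V (y [^] k)"
      using dcosets_iff[OF V', of "y [^] k" "g \<otimes> y [^] k"] g y by (simp add: S_def)
    then obtain u v where uv: "u \<in> V" "v \<in> V" "g \<otimes> y [^] k = u \<otimes> y [^] k \<otimes> v"
      by (auto simp: mem_double_coset_iff)
    then have "g = u \<otimes> y [^] k \<otimes> v \<otimes> inv (y [^] k)"
      using g y V.mem_carrier by (metis inv_solve_right' m_closed nat_pow_closed)
    then show ?thesis
      using uv by blast
  qed
  moreover have "inv y \<otimes> g \<otimes> y \<in> U" if "g \<in> U" for g
  proof -
    have g: "g \<in> carrier G" "(\<lambda>A. g <# A) ` S k = S k"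
      using that by (auto simp: U_def)
    \<comment> \<open>An automorphism preserving level \<open>k\<close> preserves the set of its
      out-neighbours, which is level \<open>Suc k\<close>.\<close>
    have "(\<lambda>B. g <# B) ` S (Suc k) = (\<lambda>B. g <# B) ` \<Union> (out_neighbours V y ` S k)"
      using Union_out_neighbours_dcosets[OF V' y p, of k] by (simp add: S_def)
    also have "\<dots> = \<Union> ((\<lambda>A. (\<lambda>B. g <# B) ` out_neighbours V y A) ` S k)"
      by (rule image_Union[of _ "out_neighbours V y ` S k", unfolded image_image])
    also have "\<dots> = \<Union> ((\<lambda>A. out_neighbours V y (g <# A)) ` S k)"
      using SP by (intro arg_cong[of _ _ Union] image_cong refl translate_out_neighbours[symmetric]
          V.subset y g) blast
    also have "\<dots> = \<Union> (out_neighbours V y ` S k)"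
      using g(2) by (metis image_image)
    also have "\<dots> = S (Suc k)"
      using Union_out_neighbours_dcosets[OF V' y p, of k] by (simp add: S_def)
    finally have gS: "(\<lambda>B. g <# B) ` S (Suc k) = S (Suc k)" .
    \<comment> \<open>Conjugation by \<open>y\<close> exchanges the stabilizers of the two levels,
      since \<open>y\<close> maps level \<open>k\<close> onto level \<open>Suc k\<close>.\<close>
    have "(\<lambda>A. (inv y \<otimes> g \<otimes> y) <# A) ` S k = (\<lambda>A. inv y <# A) ` (\<lambda>A. g <# A) ` (\<lambda>A. y <# A) ` S k"
      using g y by (simp add: comp m_assoc)
    also have "\<dots> = (\<lambda>A. inv y <# A) ` (\<lambda>A. y <# A) ` S k"
      using yS gS by simp
    also have "\<dots> = S k"
      using y one by (subst comp) auto
    finally show ?thesis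
      using g y by (simp add: U_def)
  qed
  ultimately show ?thesis
    by blast
qed

text \<open>With finite sets \<open>E\<close>, \<open>F\<close> of representatives of
  \<open>V\<close> and \<open>U\<close> modulo the intersection, every coset of \<open>V\<close> in
  V g V has the form e c g f V, where c g U runs over the cosets of \<open>U\<close> in U g U. So
  \<open>c\<close> can be \<open>card E * card F\<close>.\<close>

lemma dindex_le_dindex:
  assumes V: "subgroup V G" and U: "commensurated U"
    and finV: "finite ((\<lambda>v. v <# (U \<inter> V)) ` V)" and finU: "finite ((\<lambda>u. u <# (U \<inter> V)) ` U)"
  shows "\<exists>c. \<forall>g\<in>carrier G. dindex V g \<le> c * dindex U g"
proof -
  interpret V: subgroup V G by fact
  interpret U: subgroup U G
    using U by (simp add: commensurated_def)
  have U': "subgroup U G" ..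
  let ?X = "U \<inter> V"
  have X: "subgroup ?X G"
    using U' V by (rule subgroups_Inter_pair)
  have reps: "\<exists>E\<subseteq>Y. finite E \<and> (\<forall>y\<in>Y. \<exists>e\<in>E. \<exists>x\<in>?X. y = e \<otimes> x)"
    if Y: "subgroup Y G" "finite ((\<lambda>v. v <# ?X) ` Y)" for Y
  proof -
    obtain E where E: "E \<subseteq> Y" "finite E" "(\<lambda>v. v <# ?X) ` Y = (\<lambda>v. v <# ?X) ` E"
      using finite_subset_image[OF Y(2) order_refl] by metis
    have "\<exists>e\<in>E. \<exists>x\<in>?X. y = e \<otimes> x" if "y \<in> Y" for y
    proof -
      have "y <# ?X \<in> (\<lambda>v. v <# ?X) ` E"
        using E that by blast
      moreover have "y \<in> y <# ?X"
        using lcos_self[OF _ X] Y that subgroup.mem_carrier by metis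
      ultimately show ?thesis
        by (auto simp: l_coset_def)
    qed
    then show ?thesis
      using E by blast
  qed
  obtain E where E: "E \<subseteq> V" "finite E" "\<And>v. v \<in> V \<Longrightarrow> \<exists>e\<in>E. \<exists>x\<in>?X. v = e \<otimes> x"
    using reps[OF V finV] by metis
  obtain F where F: "F \<subseteq> U" "finite F" "\<And>v. v \<in> U \<Longrightarrow> \<exists>e\<in>F. \<exists>x\<in>?X. v = e \<otimes> x"
    using reps[OF U' finU] by metis
  have "dindex V g \<le> (card E * card F) * dindex U g" if g: "g \<in> carrier G" for g
  proof -
    \<comment> \<open>\<open>R\<close> holds exactly one \<open>u\<close> for each coset u g U, so
      its size is \<open>dindex U g\<close>.\<close>
    obtain R where R: "R \<subseteq> U" "inj_on (\<lambda>u. (u \<otimes> g) <# U) R"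
      "dcosets U g = (\<lambda>u. (u \<otimes> g) <# U) ` R"
      using subset_image_inj[of "dcosets U g" "\<lambda>u. (u \<otimes> g) <# U" U] by (auto simp: dcosets_def)
    have finR: "finite R"
      using R(3) U g finite_image_iff[OF R(2)] by (metis commensurated_def)
    have cardR: "card R = dindex U g"
      using R by (simp add: dindex_def card_image)
    have "dcosets V g \<subseteq> (\<lambda>(e, f, c). (e \<otimes> c \<otimes> g \<otimes> f) <# V) ` (E \<times> F \<times> R)"
    proof
      fix B assume "B \<in> dcosets V g"
      then obtain v where v: "v \<in> V" "B = (v \<otimes> g) <# V"
        by (auto simp: dcosets_def)
      obtain e x where ex: "e \<in> E" "x \<in> ?X" "v = e \<otimes> x"
        using E v by blast
      have "(x \<otimes> g) <# U \<in> dcosets U g"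
        using ex by (auto simp: dcosets_def)
      then obtain c where c: "c \<in> R" "(x \<otimes> g) <# U = (c \<otimes> g) <# U"
        using R by auto
      have "x \<otimes> g \<in> (c \<otimes> g) <# U"
        using c ex g U.mem_carrier lcos_self[OF _ U', of "x \<otimes> g"] by auto
      then obtain u where u: "u \<in> U" "x \<otimes> g = c \<otimes> g \<otimes> u"
        by (auto simp: l_coset_def)
      obtain f x' where f: "f \<in> F" "x' \<in> ?X" "u = f \<otimes> x'"
        using F u by blast
      have car: "e \<in> carrier G" "x \<in> carrier G" "c \<in> carrier G" "f \<in> carrier G" "x' \<in> carrier G"
        using ex(1,2) f(1,2) c(1) E(1) F(1) R(1) by (auto intro: V.mem_carrier U.mem_carrier)
      have "v \<otimes> g = e \<otimes> (x \<otimes> g)"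
        using ex car g by (simp add: m_assoc)
      also have "\<dots> = (e \<otimes> c \<otimes> g \<otimes> f) \<otimes> x'"
        unfolding u(2) f(3) using car g by (simp add: m_assoc)
      finally have "B = (e \<otimes> c \<otimes> g \<otimes> f) <# V"
        using v f car g lcos_absorb[OF V, of "e \<otimes> c \<otimes> g \<otimes> f" x'] by simp
      then show "B \<in> (\<lambda>(e, f, c). (e \<otimes> c \<otimes> g \<otimes> f) <# V) ` (E \<times> F \<times> R)"
        using ex(1) f(1) c(1) by (intro image_eqI[of _ _ "(e, f, c)"]) auto
    qed
    then have "dindex V g \<le> card (E \<times> F \<times> R)"
      unfolding dindex_def using E F finR by (intro surj_card_le finite_cartesian_product)
    then show ?thesis
      by (simp add: card_cartesian_product cardR mult.assoc)
  qed
  then show ?thesis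
    by blast
qed

text \<open>A union bound: each vertex of a level has \<open>dindex V y\<close> out-neighbours, and
  these exhaust the next level.\<close>

lemma dindex_pow_le:
  assumes V: "commensurated V" and y: "y \<in> carrier G" and p: "path_transitive V y"
  shows "dindex V (y [^] (k::nat)) \<le> dindex V y ^ k"
proof (induction k)
  interpret V: subgroup V G
    using V by (simp add: commensurated_def)
  case 0
  have "dcosets V \<one> = {V}"
  proof -
    have "(u \<otimes> \<one>) <# V = V" if "u \<in> V" for u
      using that lcos_absorb[OF V.subgroup_axioms one_closed that] V.mem_carrier lcos_mult_one[OF V.subset]
      by simp
    then have "dcosets V \<one> = (\<lambda>_. V) ` V"
      by (simp add: dcosets_def del: r_one)
    then show ?thesis
      using image_constant[OF V.one_closed] by simp
  qed
  then show ?case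
    by (simp add: dindex_def)
next
  interpret V: subgroup V G
    using V by (simp add: commensurated_def)
  case (Suc k)
  let ?S = "dcosets V (y [^] k)"
  have fin: "finite ?S"
    using V y by (simp add: commensurated_def)
  have "dindex V (y [^] Suc k) = card (\<Union> (out_neighbours V y ` ?S))"
    using Union_out_neighbours_dcosets[OF V.subgroup_axioms y p, of k] by (simp add: dindex_def)
  also have "\<dots> \<le> (\<Sum>A\<in>?S. card (out_neighbours V y A))"
    using fin by (rule card_UN_le)
  also have "\<dots> = (\<Sum>A\<in>?S. dindex V y)"
    using y V.mem_carrier card_out_neighbours[OF V.subgroup_axioms y]
    by (intro sum.cong refl) (auto simp: dcosets_def)
  also have "\<dots> = dindex V (y [^] k) * dindex V y"
    by (simp add: dindex_def)
  finally show ?case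
    using Suc by (metis le_trans mult.commute mult_le_mono2 power_Suc)
qed

text \<open>The hypothesis says that z^-1 U z is inside \<open>U\<close>, so U z^k U collapses to
  the single coset z^k U.\<close>

lemma dindex_eq_one:
  assumes U: "subgroup U G" and z: "z \<in> carrier G" and zU: "\<And>g. g \<in> U \<Longrightarrow> inv z \<otimes> g \<otimes> z \<in> U"
  shows "dindex U (z [^] (k::nat)) = 1"
proof -
  interpret U: subgroup U G by fact
  have pow: "inv (z [^] k) \<otimes> g \<otimes> z [^] k \<in> U" if "g \<in> U" for g and k :: nat
    using that
  proof (induction k arbitrary: g)
    case 0
    then show ?case
      using U.mem_carrier by simp
  next
    case (Suc k)
    have "inv (z [^] Suc k) \<otimes> g \<otimes> z [^] Suc k = inv z \<otimes> (inv (z [^] k) \<otimes> g \<otimes> z [^] k) \<otimes> z"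
      using z Suc.prems U.mem_carrier by (simp add: inv_mult_group m_assoc)
    then show ?case
      using zU Suc by simp
  qed
  have "(u \<otimes> z [^] k) <# U = z [^] k <# U" if u: "u \<in> U" for u
  proof -
    have "u \<otimes> z [^] k = z [^] k \<otimes> (inv (z [^] k) \<otimes> u \<otimes> z [^] k)"
      using u z U.mem_carrier by (simp flip: m_assoc)
    then show ?thesis
      using lcos_absorb[OF U _ pow[OF u, of k]] z by simp
  qed
  then have "dcosets U (z [^] k) = (\<lambda>_. z [^] k <# U) ` U"
    by (simp add: dcosets_def)
  then have "dcosets U (z [^] k) = {z [^] k <# U}"
    using image_constant[OF U.one_closed] by simp
  then show ?thesis
    by (simp add: dindex_def)
qed

end

subsection \<open>Totally disconnected, locally compact groups\<close>

context group
begin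

lemma subgroup_conjugate_set:
  assumes x: "x \<in> carrier G" and V: "subgroup V G"
  shows "subgroup (conjugate_set G x V) G"
proof -
  interpret V: subgroup V G by fact
  have V_ne: "V \<noteq> {}"
    using V.one_closed by blast
  show ?thesis
  proof (rule subgroupI)
    show "conjugate_set G x V \<subseteq> carrier G"
      using x V.mem_carrier by (auto simp: conjugate_set_def)
    show "conjugate_set G x V \<noteq> {}"
      using V_ne by (auto simp: conjugate_set_def)
    show "inv g \<in> conjugate_set G x V" if "g \<in> conjugate_set G x V" for g
      using that x V.mem_carrier V.m_inv_closed
      by (auto simp: conjugate_set_def conj_inv[symmetric])
    show "g \<otimes> h \<in> conjugate_set G x V" if gh: "g \<in> conjugate_set G x V" "h \<in> conjugate_set G x V" for g h
    proof -
      obtain a b where "a \<in> V" "b \<in> V" "g = x \<otimes> a \<otimes> inv x" "h = x \<otimes> b \<otimes> inv x"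
        using gh by (auto simp: conjugate_set_def)
      then have "g \<otimes> h = x \<otimes> (a \<otimes> b) \<otimes> inv x" "a \<otimes> b \<in> V"
        using x V.mem_carrier by (simp_all add: conj_mult)
      then show ?thesis
        by (auto simp: conjugate_set_def)
    qed
  qed
qed

lemma subgroup_index_eq_card: "subgroup_index G K L = card ((\<lambda>a. a <# L) ` K)"
  by (simp add: subgroup_index_def LCOSETS_def l_coset_def UNION_singleton_eq_range)

end

section \<open>Open subgroups and finiteness of coset counts\<close>

context topological_group
begin

lemma continuous_map_mult:
  assumes "continuous_map X T f" "continuous_map X T g"
  shows "continuous_map X T (\<lambda>x. f x \<otimes> g x)"
proof -
  have "continuous_map X T ((\<lambda>(x, y). x \<otimes> y) \<circ> (\<lambda>x. (f x, g x)))"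
    using assms continuous_mult by (intro continuous_map_compose[where X' = "prod_topology T T"])
      (auto simp: continuous_map_paired)
  then show ?thesis
    by (simp add: o_def)
qed

lemma continuous_map_group_const: "a \<in> carrier G \<Longrightarrow> continuous_map X T (\<lambda>_. a)"
  by (simp add: topspace_eq_carrier)

lemma continuous_map_conj:
  "a \<in> carrier G \<Longrightarrow> b \<in> carrier G \<Longrightarrow> continuous_map T T (\<lambda>x. a \<otimes> x \<otimes> b)"
  by (intro continuous_map_mult continuous_map_group_const) auto

lemma openin_lcos:
  assumes "openin T U" "a \<in> carrier G"
  shows "openin T (a <# U)"
proof -
  have U: "U \<subseteq> carrier G"
    using assms openin_subset topspace_eq_carrier by blast
  have "a <# U = {x \<in> topspace T. inv a \<otimes> x \<in> U}"
  proof safe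
    fix x assume "x \<in> a <# U"
    then obtain u where u: "u \<in> U" "x = a \<otimes> u"
      by (auto simp: l_coset_def)
    then have "u \<in> carrier G"
      using U by blast
    then show "x \<in> topspace T" "inv a \<otimes> x \<in> U"
      using u assms by (simp_all add: topspace_eq_carrier flip: m_assoc)
  next
    fix x assume "x \<in> topspace T" "inv a \<otimes> x \<in> U"
    moreover from this have "x = a \<otimes> (inv a \<otimes> x)"
      using assms by (simp add: topspace_eq_carrier flip: m_assoc)
    ultimately show "x \<in> a <# U"
      unfolding l_coset_def by (metis (no_types, lifting) UN_I singletonI)
  qed
  moreover have "continuous_map T T (\<lambda>x. inv a \<otimes> x)"
    using assms by (intro continuous_map_mult continuous_map_group_const) auto
  then have "openin T {x \<in> topspace T. inv a \<otimes> x \<in> U}"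
    by (rule openin_continuous_map_preimage[OF _ assms(1)])
  ultimately show ?thesis
    by simp
qed

lemma openin_subgroup:
  assumes V: "subgroup V G" and U: "openin T U" "\<one> \<in> U" "U \<subseteq> V"
  shows "openin T V"
proof -
  interpret V: subgroup V G by fact
  have "\<Union> ((\<lambda>v. v <# U) ` V) = V"
  proof safe
    fix x v assume "v \<in> V" "x \<in> v <# U"
    then show "x \<in> V"
      using U by (auto simp: l_coset_def)
  next
    fix x assume x: "x \<in> V"
    then have "x \<in> x <# U"
      using U V.mem_carrier by (auto simp: l_coset_def intro!: bexI[of _ \<one>])
    then show "x \<in> \<Union> ((\<lambda>v. v <# U) ` V)"
      using x by blast
  qed
  moreover have "openin T (\<Union> ((\<lambda>v. v <# U) ` V))"
    using U V.mem_carrier openin_lcos by (intro openin_Union) auto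
  ultimately show ?thesis
    by simp
qed

lemma closedin_open_subgroup:
  assumes V: "subgroup V G" and op: "openin T V"
  shows "closedin T V"
proof -
  interpret V: subgroup V G by fact
  have "\<Union> ((\<lambda>g. g <# V) ` (carrier G - V)) = carrier G - V"
  proof safe
    fix x g assume g: "g \<in> carrier G" "g \<notin> V" and x: "x \<in> g <# V"
    obtain v where v: "v \<in> V" "x = g \<otimes> v"
      using x by (auto simp: l_coset_def)
    then show "x \<in> carrier G"
      using g V.mem_carrier by simp
    assume "x \<in> V"
    then have "x \<otimes> inv v \<in> V"
      using v by simp
    then show False
      using v g V.mem_carrier by (simp add: m_assoc)
  next
    fix x assume "x \<in> carrier G" "x \<notin> V"
    then show "x \<in> \<Union> ((\<lambda>g. g <# V) ` (carrier G - V))"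
      using lcos_self[OF _ V] by blast
  qed
  moreover have "openin T (\<Union> ((\<lambda>g. g <# V) ` (carrier G - V)))"
    using openin_lcos[OF op] by (intro openin_Union) auto
  ultimately show ?thesis
    using V.subset by (simp add: closedin_def topspace_eq_carrier)
qed

text \<open>Cosets of an open subgroup form an open cover by disjoint sets, so a finite subcover of
  \<open>K\<close> contains every coset that meets \<open>K\<close>.\<close>

lemma finite_cosets_compact:
  assumes V: "subgroup V G" and op: "openin T V" and K: "compactin T K"
  shows "finite ((\<lambda>a. a <# V) ` K)"
proof -
  have Kc: "K \<subseteq> carrier G"
    using K compactin_subset_topspace topspace_eq_carrier by blast
  have "K \<subseteq> \<Union> ((\<lambda>a. a <# V) ` K)"
    using Kc lcos_self[OF _ V] by blast
  moreover have "\<forall>U \<in> (\<lambda>a. a <# V) ` K. openin T U"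
    using Kc openin_lcos[OF op] by blast
  ultimately obtain F where F: "finite F" "F \<subseteq> (\<lambda>a. a <# V) ` K" "K \<subseteq> \<Union> F"
    using K unfolding compactin_def by meson
  have "a <# V \<in> F" if aK: "a \<in> K" for a
  proof -
    obtain B where B: "B \<in> F" "a \<in> B"
      using F(3) aK by auto
    then obtain b where b: "b \<in> K" "B = b <# V"
      using F(2) by auto
    note b = b(1) B[unfolded b(2)]
    then have "b <# V = a <# V"
      using lcos_eq_iff[OF V, of b a] Kc aK by blast
    then show ?thesis
      using b by simp
  qed
  then have "(\<lambda>a. a <# V) ` K \<subseteq> F"
    by (rule image_subsetI)
  then show ?thesis
    using F(1) by (rule finite_subset)
qed

definition compact_open_subgroup :: "'a set \<Rightarrow> bool" where
  "compact_open_subgroup V \<longleftrightarrow> subgroup V G \<and> compactin T V \<and> openin T V"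

lemma compact_open_subgroup_commensurated:
  assumes V: "compact_open_subgroup V"
  shows "commensurated V"
proof -
  have V': "subgroup V G" "compactin T V" "openin T V"
    using V by (auto simp: compact_open_subgroup_def)
  have "finite (dcosets V g)" if g: "g \<in> carrier G" for g
  proof -
    have "continuous_map T T (\<lambda>u. u \<otimes> g)"
      using g by (intro continuous_map_mult continuous_map_group_const) auto
    then have "compactin T ((\<lambda>u. u \<otimes> g) ` V)"
      by (rule image_compactin[OF V'(2)])
    then have "finite ((\<lambda>a. a <# V) ` (\<lambda>u. u \<otimes> g) ` V)"
      by (rule finite_cosets_compact[OF V'(1,3)])
    then show ?thesis
      by (simp add: dcosets_def image_image)
  qed
  then show ?thesis
    using V' by (simp add: commensurated_def)
qed

text \<open>Exponential growth is thus independent of the compact open subgroup in which it is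
  measured.\<close>

lemma compact_open_subgroup_dindex_le:
  assumes V: "compact_open_subgroup V" and U: "compact_open_subgroup U"
  shows "\<exists>c. \<forall>g\<in>carrier G. dindex V g \<le> c * dindex U g"
proof (rule dindex_le_dindex)
  have "subgroup (U \<inter> V) G" "openin T (U \<inter> V)"
    using V U by (auto simp: compact_open_subgroup_def intro: subgroups_Inter_pair)
  note finite_cosets_compact[OF this]
  then show "finite ((\<lambda>v. v <# (U \<inter> V)) ` V)" "finite ((\<lambda>u. u <# (U \<inter> V)) ` U)"
    using V U by (auto simp: compact_open_subgroup_def)
qed (use V U compact_open_subgroup_commensurated in \<open>auto simp: compact_open_subgroup_def\<close>)

lemma compact_open_subgroup_iterated_core:
  assumes V: "compact_open_subgroup V" and y: "y \<in> carrier G"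
  shows "compact_open_subgroup (iterated_core V y n)"
proof -
  have V': "subgroup V G" "compactin T V" "openin T V"
    using V by (auto simp: compact_open_subgroup_def)
  let ?P = "\<lambda>i. {g \<in> topspace T. y [^] i \<otimes> g \<otimes> inv (y [^] i) \<in> V}"
  have "iterated_core V y n = (\<Inter>i\<in>{..n}. ?P i)"
    by (auto simp: iterated_core_def topspace_eq_carrier)
  moreover have "openin T (?P i)" for i :: nat
    using y by (intro openin_continuous_map_preimage[OF _ V'(3)] continuous_map_conj) auto
  then have "openin T (\<Inter>i\<in>{..n}. ?P i)"
    by (intro openin_INT2) auto
  ultimately have op: "openin T (iterated_core V y n)"
    by simp
  have sg: "subgroup (iterated_core V y n) G"
    by (rule subgroup_iterated_core[OF V'(1) y])
  have "compactin T (iterated_core V y n)"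
    using closed_compactin[OF V'(2) iterated_core_subset[OF y] closedin_open_subgroup[OF sg op]] .
  then show ?thesis
    using op sg by (simp add: compact_open_subgroup_def)
qed

end

section \<open>Van Dantzig's theorem and the growth dichotomy\<close>

context tdlc_group
begin

text \<open>In a compact Hausdorff neighbourhood \<open>K\<close> of the identity, quasi-components
  are connected components, hence points. So a set clopen in \<open>K\<close> separates the identity
  from the compact set \<open>K - U\<close>.\<close>

lemma ex_compact_open_nhd:
  obtains C where "openin T C" "compactin T C" "\<one> \<in> C"
proof -
  have one: "\<one> \<in> topspace T"
    by (simp add: topspace_eq_carrier)
  then obtain U K where UK: "openin T U" "compactin T K" "\<one> \<in> U" "U \<subseteq> K"
    using locally_compact unfolding locally_compact_space_def by meson
  define X where "X = subtopology T K"
  have topX: "topspace X = K"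
    using UK compactin_subset_topspace by (auto simp: X_def)
  have X: "compact_space X" "Hausdorff_space X"
    using UK Hausdorff by (simp_all add: X_def compact_space_subtopology Hausdorff_space_subtopology)
  have "connectedin T (connected_component_of_set X \<one>)"
    using connectedin_connected_component_of[of X \<one>] by (simp add: X_def connectedin_subtopology)
  then obtain a where a: "connected_component_of_set X \<one> \<subseteq> {a}"
    using totally_disconnected unfolding totally_disconnected_space_def by blast
  have "quasi_component_of_set X \<one> = connected_component_of_set X \<one>"
    using quasi_eq_connected_component_of[of X \<one>] X by simp
  moreover have "\<one> \<in> quasi_component_of_set X \<one>"
    using UK topX by auto
  ultimately have "quasi_component_of_set X \<one> = {\<one>}"
    using a by blast
  then have qc: "{\<one>} \<in> quasi_components_of X"
    using UK topX by (metis quasi_component_in_quasi_components_of subsetD)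
  have "closedin X (K - U)"
  proof -
    have "openin X (K \<inter> U)"
      unfolding X_def using UK(1) by (rule openin_subtopology_Int2)
    then have "closedin X (topspace X - K \<inter> U)"
      by blast
    then show ?thesis
      by (simp add: topX Diff_Int_distrib Diff_Int)
  qed
  then have "compactin X (K - U)"
    using X closedin_compact_space by blast
  then have "separated_between X {\<one>} (K - U)"
    using separated_between_quasi_component_compact[OF qc] UK by (simp add: disjnt_def)
  then obtain C D where CD: "openin X C" "openin X D" "C \<union> D = K" "disjnt C D" "\<one> \<in> C" "K - U \<subseteq> D"
    unfolding separated_between_def topX by auto
  \<comment> \<open>Lying inside the open set \<open>U\<close> turns openness of \<open>C\<close>
    relative to \<open>K\<close> into openness in \<open>T\<close>.\<close>
  have CU: "C \<subseteq> U"
    using CD by (auto simp: disjnt_iff)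
  have "C = topspace X - D"
    using CD topX by (auto simp: disjnt_iff)
  then have "closedin X C"
    using CD by blast
  then have "compactin T C"
    using X closedin_compact_space unfolding X_def by (metis compactin_subtopology)
  moreover obtain O' where O': "openin T O'" "C = O' \<inter> K"
    using CD(1) unfolding X_def openin_subtopology by blast
  then have "C = O' \<inter> U"
    using CU UK by blast
  then have "openin T C"
    using O' UK by blast
  ultimately show thesis
    using that CD by blast
qed

text \<open>Van Dantzig's theorem: the right stabilizer of a compact open set \<open>C\<close>
  containing the identity is a subgroup inside \<open>C\<close>, and it is open by the tube
  lemma.\<close>

lemma ex_compact_open_subgroup: "\<exists>V. compact_open_subgroup V"
proof -
  obtain C where C: "openin T C" "compactin T C" "\<one> \<in> C"
    using ex_compact_open_nhd by blast
  have Cc: "C \<subseteq> carrier G"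
    using C openin_subset topspace_eq_carrier by blast
  define V where "V = {g \<in> carrier G. \<forall>c\<in>C. c \<otimes> g \<in> C \<and> c \<otimes> inv g \<in> C}"
  have sg: "subgroup V G"
  proof (rule subgroupI)
    show "V \<noteq> {}"
      using Cc by (auto simp: V_def subset_iff intro!: exI[of _ \<one>])
    show "g \<otimes> h \<in> V" if "g \<in> V" "h \<in> V" for g h
      using that Cc by (auto simp: V_def inv_mult_group subset_iff simp flip: m_assoc)
  qed (auto simp: V_def)
  have VC: "V \<subseteq> C"
    using C by (auto simp: V_def)
  have "openin (prod_topology T T) {p \<in> topspace (prod_topology T T). (case p of (x, y) \<Rightarrow> x \<otimes> y) \<in> C}"
    using continuous_mult C(1) by (rule openin_continuous_map_preimage)
  moreover have "C \<times> {\<one>} \<subseteq> {p \<in> topspace (prod_topology T T). (case p of (x, y) \<Rightarrow> x \<otimes> y) \<in> C}"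
    using Cc by (auto simp: topspace_eq_carrier)
  moreover have "compactin T {\<one>}"
    by (simp add: topspace_eq_carrier)
  ultimately obtain A N where N: "openin T N" "C \<subseteq> A" "{\<one>} \<subseteq> N"
    "A \<times> N \<subseteq> {p \<in> topspace (prod_topology T T). (case p of (x, y) \<Rightarrow> x \<otimes> y) \<in> C}"
    using C(2) by (rule_tac Wallace_theorem_prod_topology)
  \<comment> \<open>The neighbourhood is made symmetric because membership in \<open>V\<close>
    restricts both \<open>g\<close> and its inverse.\<close>
  define N' where "N' = N \<inter> {x \<in> topspace T. inv x \<in> N}"
  have "openin T N'"
    unfolding N'_def using N(1) openin_continuous_map_preimage[OF continuous_inv N(1)] by blast
  moreover have "\<one> \<in> N'"
    using N by (simp add: N'_def topspace_eq_carrier)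
  moreover have "N' \<subseteq> V"
    using N(2,4) by (fastforce simp: N'_def V_def topspace_eq_carrier)
  ultimately have op: "openin T V"
    using openin_subgroup[OF sg] by blast
  then have "compactin T V"
    using closed_compactin[OF C(2) VC] closedin_open_subgroup[OF sg] by blast
  then show ?thesis
    using sg op by (auto simp: compact_open_subgroup_def)
qed

lemma ex_compact_open_path_transitive:
  assumes y: "y \<in> carrier G"
  shows "\<exists>V. compact_open_subgroup V \<and> path_transitive V y"
proof -
  obtain V where V: "compact_open_subgroup V"
    using ex_compact_open_subgroup by blast
  then have "subgroup V G" "finite (dcosets V y)"
    using compact_open_subgroup_commensurated y by (auto simp: commensurated_def)
  then obtain N where "path_transitive (iterated_core V y N) y"
    using ex_path_transitive_iterated_core[OF _ y] by blast
  then show ?thesis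
    using compact_open_subgroup_iterated_core[OF V y] by blast
qed

text \<open>If the growth stops, the stabilizer \<open>U\<close> of a level is open since it
  contains \<open>V\<close>, and compact since it is closed and lies in the compact set V y^k V
  y^-k.\<close>

lemma compact_open_in_conj_or_exponential_growth:
  assumes y: "y \<in> carrier G"
  shows "(\<exists>U. compact_open_subgroup U \<and> (\<forall>g\<in>U. inv y \<otimes> g \<otimes> y \<in> U)) \<or>
    (\<exists>V K. compact_open_subgroup V \<and> path_transitive V y \<and>
      (\<forall>k. 2 ^ k \<le> dindex V (y [^] (K + k :: nat))))"
proof -
  obtain V where V: "compact_open_subgroup V" and p: "path_transitive V y"
    using ex_compact_open_path_transitive[OF y] by blast
  have cV: "commensurated V"
    by (rule compact_open_subgroup_commensurated[OF V])
  have V': "subgroup V G" "compactin T V" "openin T V"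
    using V by (auto simp: compact_open_subgroup_def)
  interpret V: subgroup V G by fact
  show ?thesis
  proof (rule disjE[OF dindex_growth[OF cV y p]])
    assume "\<exists>k. dindex V (y [^] Suc k) = dindex V (y [^] k)"
    then obtain k where "dindex V (y [^] Suc k) = dindex V (y [^] k)"
      by blast
    from ex_subgroup_in_conj[OF cV y p this] obtain U where U: "subgroup U G" "V \<subseteq> U"
      "\<And>g. g \<in> U \<Longrightarrow> \<exists>u\<in>V. \<exists>v\<in>V. g = u \<otimes> y [^] k \<otimes> v \<otimes> inv (y [^] k)"
      "\<And>g. g \<in> U \<Longrightarrow> inv y \<otimes> g \<otimes> y \<in> U"
      by metis
    have op: "openin T U"
      using openin_subgroup[OF U(1) V'(3) _ U(2)] by simp
    let ?f = "\<lambda>(u, v). u \<otimes> y [^] k \<otimes> v \<otimes> inv (y [^] k)"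
    have "continuous_map (prod_topology T T) T ?f"
      unfolding case_prod_beta
      using y by (intro continuous_map_mult continuous_map_group_const continuous_map_fst
          continuous_map_snd) auto
    moreover have "compactin (prod_topology T T) (V \<times> V)"
      using V' by (simp add: compactin_Times)
    ultimately have "compactin T (?f ` (V \<times> V))"
      by (metis image_compactin)
    moreover have "U \<subseteq> ?f ` (V \<times> V)"
    proof
      fix g assume "g \<in> U"
      then obtain u v where "u \<in> V" "v \<in> V" "g = u \<otimes> y [^] k \<otimes> v \<otimes> inv (y [^] k)"
        using U(3) by blast
      then show "g \<in> ?f ` (V \<times> V)"
        by (intro image_eqI[of _ _ "(u, v)"]) auto
    qed
    ultimately have "compactin T U"
      using closed_compactin closedin_open_subgroup[OF U(1) op] by blast
    then show ?thesis
      using U op by (auto simp: compact_open_subgroup_def)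
  qed (use V p in blast)
qed

text \<open>The value 1 is attained at \<open>U\<close>, where x U x^-1 is its own intersection with
  \<open>U\<close>. Smaller values are excluded by finiteness of the index, as \<open>card\<close>
  gives 0 only for empty or infinite sets.\<close>

lemma scale_eq_one:
  assumes x: "x \<in> carrier G" and U: "compact_open_subgroup U"
    and xU: "\<And>g. g \<in> U \<Longrightarrow> x \<otimes> g \<otimes> inv x \<in> U"
  shows "scale G T x = 1"
  unfolding scale_def
proof (rule Least_equality)
  show "\<exists>V. subgroup V G \<and> compactin T V \<and> openin T V \<and>
      1 = subgroup_index G (conjugate_set G x V) (conjugate_set G x V \<inter> V)"
  proof (intro exI conjI)
    show U': "subgroup U G" "compactin T U" "openin T U"
      using U by (auto simp: compact_open_subgroup_def)
    have "conjugate_set G x U \<subseteq> U"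
      using xU by (auto simp: conjugate_set_def)
    then have eq: "conjugate_set G x U \<inter> U = conjugate_set G x U"
      by blast
    let ?K = "conjugate_set G x U"
    interpret K: subgroup ?K G
      by (rule subgroup_conjugate_set[OF x U'(1)])
    have "a <# ?K = ?K" if "a \<in> ?K" for a
      using lcos_eq_iff[OF K.subgroup_axioms one_closed, of a] that K.mem_carrier
      by (simp add: lcos_mult_one K.subset)
    then have "(\<lambda>a. a <# ?K) ` ?K = (\<lambda>_. ?K) ` ?K"
      by (intro image_cong) auto
    also have "\<dots> = {?K}"
      by (rule image_constant[OF K.one_closed])
    finally show "1 = subgroup_index G ?K (?K \<inter> U)"
      by (simp add: subgroup_index_eq_card eq)
  qed
next
  fix n assume "\<exists>V. subgroup V G \<and> compactin T V \<and> openin T V \<and>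
      n = subgroup_index G (conjugate_set G x V) (conjugate_set G x V \<inter> V)"
  then obtain V where V: "subgroup V G" "compactin T V" "openin T V"
    and n: "n = subgroup_index G (conjugate_set G x V) (conjugate_set G x V \<inter> V)"
    by blast
  interpret V: subgroup V G by fact
  let ?K = "conjugate_set G x V"
  have "?K = {g \<in> topspace T. inv x \<otimes> g \<otimes> x \<in> V}"
  proof safe
    fix g assume "g \<in> ?K"
    then obtain v where v: "v \<in> V" "g = x \<otimes> v \<otimes> inv x"
      by (auto simp: conjugate_set_def)
    then show "g \<in> topspace T" "inv x \<otimes> g \<otimes> x \<in> V"
      using conj_conj[of "inv x" x v] x V.mem_carrier by (auto simp: topspace_eq_carrier)
  next
    fix g assume g: "g \<in> topspace T" "inv x \<otimes> g \<otimes> x \<in> V"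
    then have "g = x \<otimes> (inv x \<otimes> g \<otimes> x) \<otimes> inv x"
      using conj_conj[of x "inv x" g] x by (auto simp: topspace_eq_carrier)
    then show "g \<in> ?K"
      using g by (auto simp: conjugate_set_def)
  qed
  then have "openin T ?K"
    using openin_continuous_map_preimage[OF continuous_map_conj[of "inv x" x] V(3)] x by simp
  then have "openin T (?K \<inter> V)"
    using V by blast
  moreover have "compactin T ?K"
    unfolding conjugate_set_def using x by (intro image_compactin[OF V(2)] continuous_map_conj) auto
  moreover have "subgroup (?K \<inter> V) G"
    using subgroup_conjugate_set[OF x] V by (intro subgroups_Inter_pair) auto
  ultimately have "finite ((\<lambda>a. a <# (?K \<inter> V)) ` ?K)"
    by (intro finite_cosets_compact)
  moreover have "V \<noteq> {}"
    using V.one_closed by blast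
  then have "?K \<noteq> {}"
    by (simp add: conjugate_set_def)
  ultimately show "1 \<le> n"
    by (simp add: n subgroup_index_eq_card Suc_le_eq card_gt_0_iff)
qed


section \<open>Recurrence on the coset space and the uniscalar theorem\<close>

text \<open>Poincare recurrence for the action of \<open>y\<close> on the coset space \<open>G/H\<close>: the translates
  \<open>y\<^sup>i V H\<close> have the same positive measure, so they cannot all be disjoint.\<close>

lemma double_coset_meets_lattice:
  assumes H: "lattice_subgroup G T H" and V: "compact_open_subgroup V" and y: "y \<in> carrier G"
  shows "\<exists>n>0. \<exists>h\<in>H. h \<in> double_coset V (y [^] (n::nat))"
proof -
  have sgH: "subgroup H G"
    using H by (simp add: lattice_subgroup_def)
  interpret H: subgroup H G by fact
  have V': "subgroup V G" "openin T V"
    using V by (auto simp: compact_open_subgroup_def)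
  interpret V: subgroup V G by (rule V'(1))
  define X where "X = coset_topology G T H"
  obtain M where rad: "radon_measure X M" and inv: "invariant_coset_measure G M"
    and "finite_measure M" and M0: "emeasure M (space M) \<noteq> 0"
    using H unfolding lattice_subgroup_def X_def by blast
  interpret M: finite_measure M by fact
  define \<pi> where "\<pi> g = g <# H" for g
  have topX: "topspace X = \<pi> ` carrier G"
    by (simp add: X_def coset_topology_def topspace_quotient_topology topspace_eq_carrier \<pi>_def)
  have spM: "space M = topspace X" and setsM: "sets M = sigma_sets (topspace X) {U. openin X U}"
    using rad by (simp_all add: radon_measure_def)
  have meas: "U \<in> sets M" if "openin X U" for U
    using that setsM by (auto intro: sigma_sets.Basic)
  \<comment> \<open>The quotient map is open: the saturation of \<open>U\<close> is a union of right
    translates of \<open>U\<close> by elements of \<open>H\<close>.\<close>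
  have open_\<pi>: "openin X (\<pi> ` U)" if U: "openin T U" for U
  proof -
    have Uc: "U \<subseteq> carrier G"
      using U openin_subset topspace_eq_carrier by blast
    have "{x \<in> topspace T. \<pi> x \<in> \<pi> ` U} = (\<Union>h\<in>H. {x \<in> topspace T. x \<otimes> h \<in> U})"
    proof safe
      fix x u assume x: "x \<in> topspace T" "\<pi> x = \<pi> u" "u \<in> U"
      then have "u \<in> x <# H"
        using lcos_eq_iff[OF sgH, of x u] Uc by (auto simp: \<pi>_def topspace_eq_carrier)
      then show "x \<in> (\<Union>h\<in>H. {x \<in> topspace T. x \<otimes> h \<in> U})"
        using x by (auto simp: l_coset_def)
    next
      fix x h assume x: "h \<in> H" "x \<in> topspace T" "x \<otimes> h \<in> U"
      then have "\<pi> x = \<pi> (x \<otimes> h)"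
        using lcos_absorb[OF sgH, of x h] by (simp add: \<pi>_def topspace_eq_carrier)
      then show "\<pi> x \<in> \<pi> ` U"
        using x by blast
    qed
    moreover have "openin T {x \<in> topspace T. x \<otimes> h \<in> U}" if "h \<in> H" for h
      using that by (intro openin_continuous_map_preimage[OF _ U] continuous_map_mult
          continuous_map_group_const) auto
    then have "openin T (\<Union>h\<in>H. {x \<in> topspace T. x \<otimes> h \<in> U})"
      by (intro openin_Union) auto
    ultimately have "openin T {x \<in> topspace T. \<pi> x \<in> \<pi> ` U}"
      by simp
    moreover have "\<pi> ` U \<subseteq> \<pi> ` topspace T"
      using Uc by (auto simp: topspace_eq_carrier)
    ultimately show ?thesis
      by (simp add: X_def coset_topology_def openin_quotient_topology \<pi>_def)
  qed
  define B where "B g = \<pi> ` (g <# V)" for g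
  have openB: "openin X (B g)" if "g \<in> carrier G" for g
    unfolding B_def by (intro open_\<pi> openin_lcos V' that)
  have B_translate: "B g = (\<lambda>C. g <# C) ` B \<one>" if g: "g \<in> carrier G" for g
  proof -
    have "g <# V = (\<lambda>v. g \<otimes> v) ` V" "\<one> <# V = V"
      by (auto simp: l_coset_def lcos_mult_one V.subset)
    moreover have "g <# (v <# H) = (g \<otimes> v) <# H" if "v \<in> V" for v
      using g that V.mem_carrier by (simp add: lcos_m_assoc H.subset)
    ultimately show ?thesis
      unfolding B_def \<pi>_def by (simp add: image_image)
  qed
  have B_meas: "emeasure M (B g) = emeasure M (B \<one>)" if "g \<in> carrier G" for g
    using inv that meas[OF openB[of \<one>]] B_translate[OF that]
    unfolding invariant_coset_measure_def by simp
  \<comment> \<open>If one translate were null, all would be; finitely many of them cover any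
    compact set, so inner regularity would make the total mass 0.\<close>
  have pos: "emeasure M (B \<one>) \<noteq> 0"
  proof
    assume zero: "emeasure M (B \<one>) = 0"
    have K_zero: "emeasure M K = 0" if K: "compactin X K" for K
    proof -
      have "K \<subseteq> \<Union> (B ` carrier G)"
      proof
        fix C assume "C \<in> K"
        then obtain g where g: "g \<in> carrier G" "C = \<pi> g"
          using compactin_subset_topspace[OF K] topX by blast
        then have "C \<in> B g"
          using lcos_self[OF g(1) V'(1)] by (auto simp: B_def)
        then show "C \<in> \<Union> (B ` carrier G)"
          using g by blast
      qed
      moreover have "\<forall>U\<in>B ` carrier G. openin X U"
        using openB by blast
      ultimately obtain F where F: "finite F" "F \<subseteq> B ` carrier G" "K \<subseteq> \<Union> F"
        using K unfolding compactin_def by meson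
      have B_null: "B g \<in> null_sets M" if "g \<in> carrier G" for g
        using meas[OF openB[OF that]] B_meas[OF that] zero by (simp add: null_sets_def)
      then have "A \<in> null_sets M" if "A \<in> F" for A
        using that F(2) by auto
      then have "\<Union> F \<in> null_sets M"
        using F(1) by (intro null_sets.finite_Union) auto
      then show ?thesis
        using F(3) by (metis emeasure_mono le_zero_eq null_setsD1 null_setsD2)
    qed
    have "emeasure M (topspace X) =
        (SUP K \<in> {K. compactin X K \<and> K \<subseteq> topspace X}. emeasure M K)"
      using rad unfolding radon_measure_def by blast
    also have "\<dots> \<le> 0"
      by (rule SUP_least) (simp add: K_zero)
    finally show False
      using M0 spM by simp
  qed
  \<comment> \<open>Infinitely many disjoint sets of equal positive measure do not fit into a finite
    measure.\<close>
  have "\<not> disjoint_family (\<lambda>i::nat. B (y [^] i))"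
  proof
    assume dis: "disjoint_family (\<lambda>i::nat. B (y [^] i))"
    have "(\<lambda>i::nat. measure M (B (y [^] i))) sums measure M (\<Union>i::nat. B (y [^] i))"
      using meas openB y by (intro M.finite_measure_UNION dis) auto
    moreover have "measure M (B (y [^] i)) = measure M (B \<one>)" for i :: nat
      using B_meas[of "y [^] i"] y by (simp add: measure_def)
    ultimately have "summable (\<lambda>i::nat. measure M (B \<one>))"
      using sums_summable by simp
    then have "measure M (B \<one>) = 0"
      by (simp add: summable_const_iff)
    then show False
      using pos by (simp add: M.emeasure_eq_measure)
  qed
  then obtain i j :: nat where ij: "i < j" "B (y [^] i) \<inter> B (y [^] j) \<noteq> {}"
    unfolding disjoint_family_on_def by (metis Int_commute linorder_neqE_nat)
  then obtain v w where vw: "v \<in> V" "w \<in> V" "\<pi> (y [^] i \<otimes> v) = \<pi> (y [^] j \<otimes> w)"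
    by (auto simp: B_def l_coset_def)
  have vwc: "v \<in> carrier G" "w \<in> carrier G"
    using vw V.mem_carrier by auto
  have "y [^] j \<otimes> w \<in> (y [^] i \<otimes> v) <# H"
    using vw vwc y lcos_eq_iff[OF sgH, of "y [^] i \<otimes> v" "y [^] j \<otimes> w"] by (simp add: \<pi>_def)
  then obtain h where h: "h \<in> H" "y [^] j \<otimes> w = y [^] i \<otimes> v \<otimes> h"
    by (auto simp: l_coset_def)
  have hc: "h \<in> carrier G"
    using h by simp
  \<comment> \<open>Cancelling \<open>y [^] i\<close> in y^j w = y^i v h leaves h = v^-1 y^n
    w.\<close>
  define n where "n = j - i"
  have n: "0 < n" "j = i + n"
    using ij by (auto simp: n_def)
  have "y [^] i \<otimes> (y [^] n \<otimes> w) = y [^] i \<otimes> (v \<otimes> h)"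
    using h(2) y vwc hc n(2) by (simp add: m_assoc flip: nat_pow_mult)
  then have "y [^] n \<otimes> w = v \<otimes> h"
    using y vwc hc by simp
  then have "h = inv v \<otimes> y [^] n \<otimes> w"
    using y vwc hc by (simp add: m_assoc inv_solve_left)
  moreover have "inv v \<in> V"
    using vw by simp
  ultimately have "h \<in> double_coset V (y [^] n)"
    using vw by (auto simp: mem_double_coset_iff)
  then show ?thesis
    using n(1) h(1) by blast
qed

text \<open>Both alternatives of the dichotomy for a deep root \<open>z\<close> of a lattice element
  \<open>h\<close> contradict exponential growth of \<open>y\<close>: the first makes the growth of
  \<open>h\<close> bounded, the second makes it too fast.\<close>

lemma ex_compact_open_in_conj:
  assumes H: "lattice_subgroup G T H" and div: "\<forall>h\<in>H. infinitely_divisible G h"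
    and y: "y \<in> carrier G"
  shows "\<exists>U. compact_open_subgroup U \<and> (\<forall>g\<in>U. inv y \<otimes> g \<otimes> y \<in> U)"
proof (rule ccontr)
  assume contra: "\<not> ?thesis"
  then obtain V K where V: "compact_open_subgroup V" and p: "path_transitive V y"
    and exp: "\<And>k. 2 ^ k \<le> dindex V (y [^] (K + k :: nat))"
    using compact_open_in_conj_or_exponential_growth[OF y] by blast
  have cV: "commensurated V"
    by (rule compact_open_subgroup_commensurated[OF V])
  have sgV: "subgroup V G"
    using V by (simp add: compact_open_subgroup_def)
  obtain n h where n: "0 < n" and h: "h \<in> H" "h \<in> double_coset V (y [^] (n::nat))"
    using double_coset_meets_lattice[OF H V y] by blast
  \<comment> \<open>The number \<open>a ^ k\<close> bounds \<open>dindex V (h [^] k)\<close>, and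
    \<open>a\<close> is fixed before any root of \<open>h\<close> is chosen.\<close>
  define a where "a = dindex V y ^ n"
  have a: "0 < a"
    using dindex_pos[OF cV y] by (simp add: a_def)
  obtain m z where z: "z \<in> carrier G" "h = z [^] (m::nat)" and m: "a + 1 \<le> m"
  proof -
    obtain e x where e: "strict_mono (e :: nat \<Rightarrow> nat)"
      and x: "\<And>k. x k \<in> carrier G \<and> h = x k [^] e k"
      using div h(1) unfolding infinitely_divisible_def by blast
    show thesis
      using that[of "x (a + 1)" "e (a + 1)"] x strict_mono_imp_increasing[OF e] by blast
  qed
  have hpow: "dindex V (z [^] (m * k)) = dindex V (y [^] (n * k))" for k
  proof -
    have "h [^] k \<in> double_coset V (y [^] (n * k))"
      by (rule path_transitive_double_coset_pow[OF sgV y p h(2)])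
    then have "dcosets V (h [^] k) = dcosets V (y [^] (n * k))"
      using y by (intro dcosets_cong[OF sgV]) auto
    then show ?thesis
      using z by (simp add: dindex_def nat_pow_pow)
  qed
  show False
  proof (rule disjE[OF compact_open_in_conj_or_exponential_growth[OF z(1)]])
    assume "\<exists>U. compact_open_subgroup U \<and> (\<forall>g\<in>U. inv z \<otimes> g \<otimes> z \<in> U)"
    then obtain U where U: "compact_open_subgroup U" "\<And>g. g \<in> U \<Longrightarrow> inv z \<otimes> g \<otimes> z \<in> U"
      by blast
    obtain c where c: "\<And>g. g \<in> carrier G \<Longrightarrow> dindex V g \<le> c * dindex U g"
      using compact_open_subgroup_dindex_le[OF V U(1)] by blast
    \<comment> \<open>The exponent is at least \<open>K + c\<close> because \<open>n > 0\<close>, so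
      the lower bound for \<open>y\<close> would give \<open>2 ^ c \<le> c\<close>.\<close>
    have "dindex V (y [^] (n * (K + c))) \<le> c"
      using c[of "z [^] (m * (K + c))"] z(1) dindex_eq_one[of U z "m * (K + c)"] U hpow[of "K + c"]
      by (simp add: compact_open_subgroup_def)
    moreover have "n * (K + c) = K + (n * (K + c) - K)"
      using n by (cases n) auto
    then have "2 ^ (n * (K + c) - K) \<le> dindex V (y [^] (n * (K + c)))"
      using exp by metis
    moreover have "c \<le> n * (K + c) - K"
      using n by (cases n) auto
    then have "(2::nat) ^ c \<le> 2 ^ (n * (K + c) - K)"
      by simp
    ultimately show False
      using less_exp[of c] by linarith
  next
    assume "\<exists>W L. compact_open_subgroup W \<and> path_transitive W z \<and>
        (\<forall>k. 2 ^ k \<le> dindex W (z [^] (L + k :: nat)))"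
    then obtain W L where W: "compact_open_subgroup W"
      and expW: "\<And>k. 2 ^ k \<le> dindex W (z [^] (L + k :: nat))"
      by blast
    obtain c where c: "\<And>g. g \<in> carrier G \<Longrightarrow> dindex W g \<le> c * dindex V g"
      using compact_open_subgroup_dindex_le[OF W V] by blast
    \<comment> \<open>This \<open>k\<close> makes \<open>m * k \<ge> L\<close>, so that the lower
      bound for \<open>z\<close> applies, and satisfies
      \<open>2 ^ L * c \<le> k < 2 ^ k\<close>.\<close>
    define k where "k = L + 2 ^ L * c"
    have mk: "m * k = L + (m * k - L)"
      using m by (cases m) (auto simp: k_def)
    \<comment> \<open>The spare factor 2 leaves \<open>2 ^ k\<close> after \<open>a ^ k\<close> is
      cancelled below.\<close>
    have "2 * a \<le> 2 ^ m"
    proof -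
      have "a \<le> 2 ^ a"
        using less_exp[of a] by simp
      then have "2 * a \<le> 2 ^ (a + 1)"
        by simp
      also have "\<dots> \<le> 2 ^ m"
        using m by (intro power_increasing) auto
      finally show ?thesis .
    qed
    then have "(2 * a) ^ k \<le> (2 ^ m) ^ k"
      by (rule power_mono) simp
    also have "\<dots> = 2 ^ L * 2 ^ (m * k - L)"
      using mk by (metis power_add power_mult)
    also have "\<dots> \<le> 2 ^ L * dindex W (z [^] (m * k))"
      using expW[of "m * k - L"] mk by simp
    also have "\<dots> \<le> 2 ^ L * (c * dindex V (y [^] (n * k)))"
      using c[of "z [^] (m * k)"] z(1) hpow[of k] by simp
    also have "\<dots> \<le> 2 ^ L * (c * a ^ k)"
      using dindex_pow_le[OF cV y p, of "n * k"] by (simp add: a_def power_mult)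
    finally have "2 ^ k * a ^ k \<le> (2 ^ L * c) * a ^ k"
      by (simp add: power_mult_distrib)
    then have "2 ^ k \<le> 2 ^ L * c"
      using a by simp
    moreover have "2 ^ L * c \<le> k"
      by (simp add: k_def)
    ultimately show False
      using less_exp[of k] by linarith
  qed
qed

lemma uniscalar_of_divisible_lattice:
  assumes H: "lattice_subgroup G T H" and div: "\<forall>h\<in>H. infinitely_divisible G h"
  shows "uniscalar G T"
  unfolding uniscalar_def
proof
  fix x assume x: "x \<in> carrier G"
  \<comment> \<open>For the inverse of \<open>x\<close> the inclusion reads x U x^-1 \<subseteq> U,
    the form that \<open>scale_eq_one\<close> takes.\<close>
  then obtain U where "compact_open_subgroup U" "\<forall>g\<in>U. inv (inv x) \<otimes> g \<otimes> inv x \<in> U"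
    using ex_compact_open_in_conj[OF H div, of "inv x"] by blast
  then show "scale G T x = 1"
    using x by (intro scale_eq_one[of x U]) auto
qed

end

subsection \<open>Fair coin tossing indexed by a countable set\<close>

text \<open>With this class the Borel sets of a countable power of \<open>bool\<close> coincide with
  the product sigma-algebra.\<close>

instance bool :: second_countable_topology
proof
  have "generate_topology UNIV = (open :: bool set \<Rightarrow> bool)"
    by (auto simp: fun_eq_iff Topological_Spaces.open_discrete intro: generate_topology.Basis)
  then show "\<exists>B :: bool set set. countable B \<and> open = generate_topology B"
    by (intro exI[of _ UNIV]) (auto intro: countable_finite)
qed

lemma euclidean_bool: "(euclidean :: bool topology) = discrete_topology UNIV"
  by (subst eq_commute, simp add: discrete_topology_unique Topological_Spaces.open_discrete)

lemma euclidean_bool_fun: "(euclidean :: ('i \<Rightarrow> bool) topology) = product_topology (\<lambda>_. discrete_topology UNIV) UNIV"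
  by (simp add: euclidean_product_topology flip: euclidean_bool)

lemma Hausdorff_space_bool_fun: "Hausdorff_space (euclidean :: ('i \<Rightarrow> bool) topology)"
  by (simp add: euclidean_bool_fun Hausdorff_space_product_topology)

lemma compact_space_bool_fun: "compact_space (euclidean :: ('i \<Rightarrow> bool) topology)"
  by (simp add: euclidean_bool_fun compact_space_product_topology compact_space_discrete_topology)

text \<open>On each open fibre of \<open>c\<close> the map agrees with a single \<open>F p\<close>.
  In the semidirect product the discrete parameter is the amount of translation.\<close>

lemma continuous_map_discrete_parameter:
  assumes c: "continuous_map X (discrete_topology UNIV) c" and F: "\<And>p. continuous_map X Y (F p)"
  shows "continuous_map X Y (\<lambda>x. F (c x) x)"
  unfolding continuous_map_def
proof (intro conjI allI impI)
  show "(\<lambda>x. F (c x) x) \<in> topspace X \<rightarrow> topspace Y"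
    using F by (auto simp: continuous_map_def Pi_iff)
  fix U assume U: "openin Y U"
  have "{x \<in> topspace X. F (c x) x \<in> U} =
      (\<Union>p. {x \<in> topspace X. c x \<in> {p}} \<inter> {x \<in> topspace X. F p x \<in> U})"
    by auto
  moreover have "openin X ({x \<in> topspace X. c x \<in> {p}} \<inter> {x \<in> topspace X. F p x \<in> U})" for p
    by (rule openin_Int[OF openin_continuous_map_preimage[OF c] openin_continuous_map_preimage[OF F U]])
      simp
  then have "openin X (\<Union>p. {x \<in> topspace X. c x \<in> {p}} \<inter> {x \<in> topspace X. F p x \<in> U})"
    by (intro openin_Union) blast
  ultimately show "openin X {x \<in> topspace X. F (c x) x \<in> U}"
    by simp
qed

text \<open>A subset of \<open>2\<^sup>I\<close> is regular because \<open>2\<^sup>I\<close> is a retract, by a measurable map, of the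
  complete metrizable space \<open>\<real>\<^sup>I\<close>, where finite Borel measures are regular.\<close>

lemma
  fixes M :: "('i :: countable \<Rightarrow> bool) measure"
  assumes sets_M: "sets M = sets borel" and fin: "finite_measure M" and A: "A \<in> sets borel"
  shows bool_fun_outer_regular: "emeasure M A = (INF U \<in> {U. A \<subseteq> U \<and> open U}. emeasure M U)"
    and bool_fun_inner_regular: "emeasure M A = (SUP K \<in> {K. K \<subseteq> A \<and> compact K}. emeasure M K)"
proof -
  interpret finite_measure M by fact
  have space_M: "space M = UNIV"
    using sets_M by (metis sets_eq_imp_space_eq space_borel)
  \<comment> \<open>\<open>\<phi>\<close> embeds the Boolean power in the real power, and
    thresholding at 1/2 is a Borel left inverse \<open>\<psi>\<close>.\<close>
  define \<phi> :: "('i \<Rightarrow> bool) \<Rightarrow> 'i \<Rightarrow> real" where "\<phi> f = (\<lambda>i. if f i then 1 else 0)" for f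
  define \<psi> :: "('i \<Rightarrow> real) \<Rightarrow> 'i \<Rightarrow> bool" where "\<psi> g = (\<lambda>i. g i > 1 / 2)" for g
  have \<psi>\<phi>: "\<psi> (\<phi> f) = f" for f
    by (auto simp: \<phi>_def \<psi>_def)
  have cont_coord: "continuous_on UNIV (\<lambda>f :: 'i \<Rightarrow> bool. if f i then 1 else 0 :: real)" for i
  proof -
    have "continuous_on UNIV (\<lambda>b. if b then 1 else 0 :: real)"
      by (simp add: continuous_on_open_vimage Topological_Spaces.open_discrete)
    then have "continuous_on UNIV ((\<lambda>b. if b then 1 else 0 :: real) \<circ> (\<lambda>f :: 'i \<Rightarrow> bool. f i))"
      by (intro continuous_on_compose continuous_on_product_coordinates) (rule continuous_on_subset, auto)
    then show ?thesis
      by (simp add: o_def)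
  qed
  have \<phi>: "continuous_on UNIV \<phi>"
    unfolding \<phi>_def by (intro continuous_on_coordinatewise_then_product cont_coord)
  have \<phi>_meas: "\<phi> \<in> M \<rightarrow>\<^sub>M borel"
    using borel_measurable_continuous_onI[OF \<phi>] sets_M by (simp cong: measurable_cong_sets)
  have "(\<lambda>g :: 'i \<Rightarrow> real. g i) \<in> borel_measurable borel" for i
    by (intro borel_measurable_continuous_onI continuous_on_product_coordinates)
  then have "(\<lambda>g :: 'i \<Rightarrow> real. g i > 1 / 2) \<in> borel \<rightarrow>\<^sub>M count_space UNIV" for i
    by measurable
  moreover have sets_bool: "sets (borel :: bool measure) = sets (count_space UNIV)"
    by (auto simp: Topological_Spaces.open_discrete intro: borel_open)
  ultimately have "(\<lambda>g :: 'i \<Rightarrow> real. g i > 1 / 2) \<in> borel_measurable borel" for i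
    using measurable_cong_sets[OF refl sets_bool, of borel] by blast
  then have \<psi>_meas: "\<psi> \<in> borel_measurable borel"
    unfolding \<psi>_def by (rule measurable_coordinatewise_then_product)
  define N where "N = distr M borel \<phi>"
  have N: "emeasure N B = emeasure M (\<phi> -` B)" if "B \<in> sets borel" for B
    using that \<phi>_meas by (simp add: N_def emeasure_distr space_M)
  \<comment> \<open>Pulling \<open>A\<close> back along \<open>\<psi>\<close> gives a Borel set
    whose preimage under \<open>\<phi>\<close> is exactly \<open>A\<close>, so regularity of
    \<open>N\<close> at \<open>B\<close> descends to \<open>M\<close> at \<open>A\<close>.\<close>
  define B where "B = \<psi> -` A"
  have B: "B \<in> sets borel"
    using measurable_sets[OF \<psi>_meas A] by (simp add: B_def)
  have \<phi>B: "\<phi> -` B = A"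
    by (auto simp: B_def \<psi>\<phi>)
  have fin_N: "emeasure N (space N) \<noteq> \<infinity>"
    using \<phi>_meas by (simp add: N_def emeasure_distr emeasure_eq_measure)
  show "emeasure M A = (INF U \<in> {U. A \<subseteq> U \<and> open U}. emeasure M U)"
  proof (rule antisym)
    show "emeasure M A \<le> (INF U \<in> {U. A \<subseteq> U \<and> open U}. emeasure M U)"
      by (intro INF_greatest emeasure_mono) (auto simp: sets_M)
    have "(INF U \<in> {U. A \<subseteq> U \<and> open U}. emeasure M U) \<le>
        (INF U \<in> {U. B \<subseteq> U \<and> open U}. emeasure N U)"
    proof (rule INF_mono)
      fix U assume "U \<in> {U. B \<subseteq> U \<and> open U}"
      then have "\<phi> -` U \<in> {U. A \<subseteq> U \<and> open U}" "emeasure M (\<phi> -` U) \<le> emeasure N U"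
        using \<phi> N \<phi>B by (auto intro: open_vimage)
      then show "\<exists>V\<in>{U. A \<subseteq> U \<and> open U}. emeasure M V \<le> emeasure N U"
        by blast
    qed
    also have "\<dots> = emeasure N B"
      using outer_regular[of N B] fin_N B by (simp add: N_def)
    also have "\<dots> = emeasure M A"
      using N[OF B] \<phi>B by simp
    finally show "(INF U \<in> {U. A \<subseteq> U \<and> open U}. emeasure M U) \<le> emeasure M A" .
  qed
  have comp: "compact (UNIV :: ('i \<Rightarrow> bool) set)"
    using compact_space_bool_fun[where 'i = 'i] by (simp add: compact_space_def)
  show "emeasure M A = (SUP K \<in> {K. K \<subseteq> A \<and> compact K}. emeasure M K)"
  proof (rule antisym)
    show "(SUP K \<in> {K. K \<subseteq> A \<and> compact K}. emeasure M K) \<le> emeasure M A"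
      using A by (intro SUP_least emeasure_mono) (auto simp: sets_M)
    have "emeasure M A = emeasure N B"
      using N[OF B] \<phi>B by simp
    also have "\<dots> = (SUP K \<in> {K. K \<subseteq> B \<and> compact K}. emeasure N K)"
      using inner_regular[of N B] fin_N B by (simp add: N_def)
    also have "\<dots> \<le> (SUP K \<in> {K. K \<subseteq> A \<and> compact K}. emeasure M K)"
    proof (rule SUP_mono)
      fix K assume "K \<in> {K. K \<subseteq> B \<and> compact K}"
      then have K: "K \<subseteq> B" "closed K"
        by (auto simp: compact_imp_closed)
      then have "closed (\<phi> -` K)"
        using \<phi> by (auto intro: closed_vimage)
      then have "compact (\<phi> -` K)"
        using compact_Int_closed[OF comp] by simp
      then show "\<exists>L\<in>{K. K \<subseteq> A \<and> compact K}. emeasure N K \<le> emeasure M L"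
        using K N[of K] \<phi>B by (intro bexI[of _ "\<phi> -` K"]) auto
    qed
    finally show "emeasure M A \<le> (SUP K \<in> {K. K \<subseteq> A \<and> compact K}. emeasure M K)" .
  qed
qed

text \<open>For countable \<open>'i\<close> this is the normalized Haar measure of a power of the
  group of order 2.\<close>

definition coin_measure :: "('i \<Rightarrow> bool) measure" where
  "coin_measure = PiM UNIV (\<lambda>_. uniform_count_measure UNIV)"

interpretation coin: product_prob_space "\<lambda>_ :: 'i. uniform_count_measure (UNIV :: bool set)" UNIV
  by (intro product_prob_spaceI prob_space_uniform_count_measure) auto

lemma sets_coin_measure: "sets (coin_measure :: ('i :: countable \<Rightarrow> bool) measure) = sets borel"
proof -
  have "sets (borel :: bool measure) = UNIV"
    by (auto simp: Topological_Spaces.open_discrete intro: borel_open)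
  then have "sets (coin_measure :: ('i \<Rightarrow> bool) measure) = sets (PiM UNIV (\<lambda>_ :: 'i. borel :: bool measure))"
    unfolding coin_measure_def by (intro sets_PiM_cong) auto
  then show ?thesis
    by (simp add: sets_PiM_equal_borel)
qed

lemma prob_space_coin_measure: "prob_space coin_measure"
  unfolding coin_measure_def by (intro prob_space_PiM prob_space_uniform_count_measure) auto

lemma space_coin_measure: "space (coin_measure :: ('i \<Rightarrow> bool) measure) = UNIV"
  by (simp add: coin_measure_def space_PiM space_uniform_count_measure)

lemma measurable_xor_reindex:
  fixes k :: "'i \<Rightarrow> bool" and s :: "'i \<Rightarrow> 'i"
  shows "(\<lambda>f i. k i \<noteq> f (s i)) \<in> coin_measure \<rightarrow>\<^sub>M coin_measure"
  unfolding coin_measure_def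
proof (rule measurable_PiM_single')
  fix i
  let ?u = "uniform_count_measure (UNIV :: bool set)"
  have "(\<lambda>f. f (s i)) \<in> PiM UNIV (\<lambda>_ :: 'i. ?u) \<rightarrow>\<^sub>M ?u"
    by (rule measurable_component_singleton) simp
  then have "(\<lambda>b. k i \<noteq> b) \<circ> (\<lambda>f. f (s i)) \<in> PiM UNIV (\<lambda>_ :: 'i. ?u) \<rightarrow>\<^sub>M ?u"
    by (rule measurable_comp) (auto simp: measurable_def space_uniform_count_measure)
  then show "(\<lambda>f. k i \<noteq> f (s i)) \<in> PiM UNIV (\<lambda>_ :: 'i. ?u) \<rightarrow>\<^sub>M ?u"
    by (simp add: o_def)
qed (auto simp: space_PiM space_uniform_count_measure)

text \<open>Permuting independent fair coins and flipping some of them preserves the probability of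
  every finite cylinder, and these determine the measure.\<close>

lemma coin_measure_invariant:
  fixes k :: "'i :: countable \<Rightarrow> bool" and s :: "'i \<Rightarrow> 'i"
  assumes s: "bij s" and B: "B \<in> sets borel"
  shows "emeasure coin_measure ((\<lambda>f i. k i \<noteq> f (s i)) -` B) = emeasure coin_measure B"
proof -
  let ?u = "uniform_count_measure (UNIV :: bool set)"
  let ?P = "PiM UNIV (\<lambda>_ :: 'i. ?u)"
  define t where "t f = (\<lambda>i. k i \<noteq> f (s i))" for f :: "'i \<Rightarrow> bool"
  have space_P: "space ?P = UNIV"
    using space_coin_measure[where 'i = 'i] by (simp add: coin_measure_def)
  have t: "t \<in> ?P \<rightarrow>\<^sub>M ?P"
    using measurable_xor_reindex[of k s] by (simp add: coin_measure_def t_def[abs_def])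
  have flip: "emeasure ?u {b. (a \<noteq> b) \<in> S} = emeasure ?u S" for a and S :: "bool set"
  proof -
    have "bij_betw (\<lambda>b. a \<noteq> b) {b. (a \<noteq> b) \<in> S} S"
      by (cases a) (auto intro!: bij_betwI[where g = "\<lambda>b. a \<noteq> b"])
    then have "card {b. (a \<noteq> b) \<in> S} = card S"
      by (rule bij_betw_same_card)
    then show ?thesis
      by (simp add: emeasure_uniform_count_measure)
  qed
  have "distr ?P ?P t = ?P"
  proof (rule measure_eqI_PiM_infinite[symmetric])
    fix A :: "'i \<Rightarrow> bool set" and J :: "'i set"
    assume J: "finite J"
    have emb: "prod_emb UNIV (\<lambda>_ :: 'i. ?u) J (Pi\<^sub>E J A) = {f \<in> space ?P. \<forall>i\<in>J. f i \<in> A i}" for A J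
      by (auto simp: prod_emb_def space_PiM PiE_iff)
    have meas: "{f \<in> space ?P. \<forall>i\<in>J. f i \<in> A i} \<in> sets ?P"
      unfolding emb[symmetric] using J by (intro sets_PiM_I) auto
    \<comment> \<open>The condition on output coordinate \<open>i\<close> restricts input coordinate
      \<open>s i\<close>, flipped by \<open>k i\<close>; here it is indexed by
      \<open>j = s i\<close>.\<close>
    define A' where "A' j = {b. (k (inv_into UNIV s j) \<noteq> b) \<in> A (inv_into UNIV s j)}" for j
    have inv_s: "inv_into UNIV s (s i) = i" for i
      using s by (simp add: bij_is_inj)
    have "emeasure (distr ?P ?P t) {f \<in> space ?P. \<forall>i\<in>J. f i \<in> A i} =
        emeasure ?P {f \<in> space ?P. \<forall>j\<in>s ` J. f j \<in> A' j}"
      using meas t by (subst emeasure_distr)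
        (auto simp: space_P t_def A'_def inv_s vimage_def intro!: arg_cong[of _ _ "emeasure ?P"])
    also have "\<dots> = (\<Prod>j\<in>s ` J. emeasure ?u (A' j))"
      using J by (intro coin.emeasure_PiM_Collect) auto
    also have "\<dots> = (\<Prod>i\<in>J. emeasure ?u (A' (s i)))"
      using s by (subst prod.reindex) (auto intro: inj_on_subset simp: bij_def)
    also have "\<dots> = (\<Prod>i\<in>J. emeasure ?u (A i))"
      by (simp only: A'_def inv_s flip)
    also have "\<dots> = emeasure ?P {f \<in> space ?P. \<forall>i\<in>J. f i \<in> A i}"
      using J by (intro coin.emeasure_PiM_Collect[symmetric]) auto
    finally show "emeasure ?P (prod_emb UNIV (\<lambda>_ :: 'i. ?u) J (Pi\<^sub>E J A)) =
        emeasure (distr ?P ?P t) (prod_emb UNIV (\<lambda>_ :: 'i. ?u) J (Pi\<^sub>E J A))"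
      by (simp add: emb)
  next
    show "finite_measure ?P"
      by (rule prob_space.finite_measure) (intro prob_space_PiM prob_space_uniform_count_measure, auto)
  qed auto
  moreover have "B \<in> sets ?P"
    using B sets_coin_measure[where 'i = 'i] by (simp add: coin_measure_def)
  ultimately show ?thesis
    using emeasure_distr[OF t, of B] by (simp add: coin_measure_def space_P t_def[abs_def])
qed

subsection \<open>A group that is not anisotropic\<close>

text \<open>The semidirect product of the compact group of all maps from the rationals to \<open>\<int>/2\<close>
  (Booleans under exclusive or) with the discrete group of rationals acting by translation.\<close>

definition lamp_group :: "((rat \<Rightarrow> bool) \<times> rat) monoid" where
  "lamp_group = \<lparr>carrier = UNIV,
     mult = (\<lambda>x y. (\<lambda>r. fst x r \<noteq> fst y (r - snd x), snd x + snd y)),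
     one = (\<lambda>_. False, 0)\<rparr>"

definition lamp_topology :: "((rat \<Rightarrow> bool) \<times> rat) topology" where
  "lamp_topology = prod_topology euclidean (discrete_topology UNIV)"

definition lamp_lattice :: "((rat \<Rightarrow> bool) \<times> rat) set" where
  "lamp_lattice = {\<lambda>_. False} \<times> UNIV"

text \<open>These are the left cosets of \<open>lamp_lattice\<close>, parametrized by the compact
  factor.\<close>

definition lamp_coset :: "(rat \<Rightarrow> bool) \<Rightarrow> ((rat \<Rightarrow> bool) \<times> rat) set" where
  "lamp_coset f = {f} \<times> UNIV"

lemma lamp_simps:
  "carrier lamp_group = UNIV"
  "x \<otimes>\<^bsub>lamp_group\<^esub> y = (\<lambda>r. fst x r \<noteq> fst y (r - snd x), snd x + snd y)"
  "\<one>\<^bsub>lamp_group\<^esub> = (\<lambda>_. False, 0)"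
  by (simp_all add: lamp_group_def)

lemma group_lamp_group: "group lamp_group"
proof (rule groupI)
  fix x :: "(rat \<Rightarrow> bool) \<times> rat"
  show "\<exists>y\<in>carrier lamp_group. y \<otimes>\<^bsub>lamp_group\<^esub> x = \<one>\<^bsub>lamp_group\<^esub>"
    by (intro bexI[of _ "(\<lambda>r. fst x (r + snd x), - snd x)"]) (auto simp: lamp_simps)
qed (auto simp: lamp_simps diff_diff_eq)

interpretation lamp: group lamp_group
  by (rule group_lamp_group)

lemma lamp_inv: "inv\<^bsub>lamp_group\<^esub> x = (\<lambda>r. fst x (r + snd x), - snd x)"
  by (rule lamp.inv_equality) (auto simp: lamp_simps)

lemma lamp_pow: "(\<lambda>_. False, q) [^]\<^bsub>lamp_group\<^esub> (n :: nat) = (\<lambda>_. False, of_nat n * q)"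
  by (induction n) (auto simp: lamp_simps algebra_simps)

lemma topspace_lamp_topology: "topspace lamp_topology = UNIV"
  by (simp add: lamp_topology_def)

lemma continuous_map_into_lamp_topology:
  assumes "\<And>r. continuous_map X (discrete_topology UNIV) (\<lambda>x. fst (f x) r)"
    and "continuous_map X (discrete_topology UNIV) (\<lambda>x. snd (f x))"
  shows "continuous_map X lamp_topology f"
  using assms
  by (simp add: lamp_topology_def euclidean_bool_fun continuous_map_pairwise
      continuous_map_componentwise_UNIV o_def)

lemma continuous_map_lamp_fst: "continuous_map lamp_topology (discrete_topology UNIV) (\<lambda>x. fst x r)"
proof -
  have "continuous_map (product_topology (\<lambda>_. discrete_topology UNIV) UNIV) (discrete_topology UNIV)
      (\<lambda>f :: rat \<Rightarrow> bool. f r)"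
    by (rule continuous_map_product_projection) simp
  then have "continuous_map lamp_topology (discrete_topology UNIV) ((\<lambda>f. f r) \<circ> fst)"
    unfolding lamp_topology_def euclidean_bool_fun
    by (rule continuous_map_compose[OF continuous_map_fst])
  then show ?thesis
    by (simp add: o_def)
qed

lemma continuous_map_lamp_snd: "continuous_map lamp_topology (discrete_topology UNIV) snd"
  unfolding lamp_topology_def by (rule continuous_map_snd)

lemma continuous_map_bool_xor:
  assumes "continuous_map X (discrete_topology UNIV) a" "continuous_map X (discrete_topology UNIV) b"
  shows "continuous_map X (discrete_topology UNIV) (\<lambda>x. a x \<noteq> (b x :: bool))"
proof -
  have "continuous_map (discrete_topology UNIV) (discrete_topology UNIV) (\<lambda>t. p \<noteq> (t :: bool))" for p
    by simp
  then have "continuous_map X (discrete_topology UNIV) (\<lambda>x. p \<noteq> b x)" for p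
    using continuous_map_compose[OF assms(2), of "discrete_topology UNIV" "\<lambda>t. p \<noteq> t"] by (simp add: o_def)
  then show ?thesis
    by (rule continuous_map_discrete_parameter[OF assms(1), of _ "\<lambda>p x. p \<noteq> b x"])
qed

lemma tdlc_group_lamp: "tdlc_group lamp_group lamp_topology"
proof unfold_locales
  show "topspace lamp_topology = carrier lamp_group"
    by (simp add: topspace_lamp_topology lamp_simps)
  let ?L = lamp_topology
  have fst1: "continuous_map (prod_topology ?L ?L) (discrete_topology UNIV) (\<lambda>z. fst (fst z) r)" for r
    using continuous_map_compose[OF continuous_map_fst continuous_map_lamp_fst[of r], of ?L] by (simp add: o_def)
  have snd1: "continuous_map (prod_topology ?L ?L) (discrete_topology UNIV) (\<lambda>z. snd (fst z))"
    using continuous_map_compose[OF continuous_map_fst continuous_map_lamp_snd, of ?L] by (simp add: o_def)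
  have fst2: "continuous_map (prod_topology ?L ?L) (discrete_topology UNIV) (\<lambda>z. fst (snd z) r)" for r
    using continuous_map_compose[OF continuous_map_snd continuous_map_lamp_fst[of r], of ?L] by (simp add: o_def)
  have snd2: "continuous_map (prod_topology ?L ?L) (discrete_topology UNIV) (\<lambda>z. snd (snd z))"
    using continuous_map_compose[OF continuous_map_snd continuous_map_lamp_snd, of ?L] by (simp add: o_def)
  \<comment> \<open>The shift is locally constant, so near each point the second factor is read at
    one fixed coordinate.\<close>
  have "continuous_map (prod_topology ?L ?L) (discrete_topology UNIV)
      (\<lambda>z. fst (fst z) r \<noteq> fst (snd z) (r - snd (fst z)))" for r
    by (intro continuous_map_bool_xor fst1
        continuous_map_discrete_parameter[OF snd1, of _ "\<lambda>p z. fst (snd z) (r - p)"] fst2)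
  moreover have "continuous_map (prod_topology ?L ?L) (discrete_topology UNIV)
      (\<lambda>z. snd (fst z) + snd (snd z))"
  proof (rule continuous_map_discrete_parameter[OF snd1, of _ "\<lambda>p z. p + snd (snd z)"])
    fix p :: rat
    have "continuous_map (discrete_topology UNIV) (discrete_topology UNIV) (\<lambda>q. p + q)"
      by simp
    from continuous_map_compose[OF snd2 this]
    show "continuous_map (prod_topology ?L ?L) (discrete_topology UNIV) (\<lambda>z. p + snd (snd z))"
      by (simp add: o_def)
  qed
  ultimately show "continuous_map (prod_topology ?L ?L) ?L (\<lambda>(x, y). x \<otimes>\<^bsub>lamp_group\<^esub> y)"
    by (intro continuous_map_into_lamp_topology) (auto simp: lamp_simps case_prod_beta)
  have "continuous_map ?L (discrete_topology UNIV) (\<lambda>x. fst x (r + snd x))" for r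
    by (intro continuous_map_discrete_parameter[OF continuous_map_lamp_snd, of _ "\<lambda>p x. fst x (r + p)"]
        continuous_map_lamp_fst)
  moreover have "continuous_map ?L (discrete_topology UNIV) (\<lambda>x. - snd x)"
  proof -
    have "continuous_map (discrete_topology UNIV) (discrete_topology UNIV) (\<lambda>q :: rat. - q)"
      by simp
    from continuous_map_compose[OF continuous_map_lamp_snd this] show ?thesis
      by (simp add: o_def)
  qed
  ultimately show "continuous_map ?L ?L (\<lambda>x. inv\<^bsub>lamp_group\<^esub> x)"
    by (intro continuous_map_into_lamp_topology) (simp_all add: lamp_inv)
  show "Hausdorff_space ?L"
    by (simp add: lamp_topology_def Hausdorff_space_prod_topology Hausdorff_space_bool_fun)
  show "locally_compact_space ?L"
    by (simp add: lamp_topology_def locally_compact_space_prod_topology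
        compact_imp_locally_compact_space compact_space_bool_fun locally_compact_space_discrete_topology)
  show "totally_disconnected_space ?L"
    unfolding totally_disconnected_space_def
  proof (intro allI impI)
    fix S assume S: "connectedin ?L S"
    \<comment> \<open>Continuous maps to discrete spaces are constant on connected sets, and the
      coordinates separate points.\<close>
    have const: "h x = h y" if h: "continuous_map ?L (discrete_topology UNIV) h" and "x \<in> S" "y \<in> S" for h :: "_ \<Rightarrow> 'x" and x y
    proof -
      have "connectedin (discrete_topology UNIV) (h ` S)"
        using connectedin_continuous_map_image[OF h S] .
      then show ?thesis
        using that by (auto simp: connectedin_discrete_topology)
    qed
    show "\<exists>a. S \<subseteq> {a}"
    proof (cases "S = {}")
      case False
      then obtain a where a: "a \<in> S"
        by blast
      have "x = a" if "x \<in> S" for x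
        using const[OF continuous_map_lamp_fst that a] const[OF continuous_map_lamp_snd that a]
        by (auto simp: prod_eq_iff)
      then show ?thesis
        by blast
    qed simp
  qed
qed

lemma not_anisotropic_lamp: "\<not> anisotropic lamp_group lamp_topology"
proof
  assume "anisotropic lamp_group lamp_topology"
  then have triv: "contraction_subgroup lamp_group lamp_topology (\<lambda>_. False, 1) = {\<one>\<^bsub>lamp_group\<^esub>}"
    by (auto simp: anisotropic_def lamp_simps)
  define g :: "(rat \<Rightarrow> bool) \<times> rat" where "g = (\<lambda>r. r = 0, 0)"
  let ?c = "\<lambda>n::nat. ((\<lambda>r. r = of_nat n), 0) :: (rat \<Rightarrow> bool) \<times> rat"
  \<comment> \<open>Conjugation by translation by \<open>n\<close> moves the lit lamp from 0 to
    \<open>n\<close>; each fixed position is eventually dark, which is pointwise convergence to the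
    identity.\<close>
  have conj: "((\<lambda>_. False, 1) [^]\<^bsub>lamp_group\<^esub> n) \<otimes>\<^bsub>lamp_group\<^esub> g \<otimes>\<^bsub>lamp_group\<^esub>
      inv\<^bsub>lamp_group\<^esub> ((\<lambda>_. False, 1) [^]\<^bsub>lamp_group\<^esub> n) = ?c n" for n :: nat
    by (auto simp: lamp_pow lamp_inv lamp_simps g_def)
  have "\<forall>\<^sub>F n in sequentially. \<not> r = of_nat n" for r :: rat
  proof -
    obtain N :: nat where "r < of_nat N"
      using reals_Archimedean2 by blast
    then show ?thesis
      by (intro eventually_sequentiallyI[of N]) (metis leD of_nat_le_iff)
  qed
  then have "limitin (discrete_topology UNIV) (\<lambda>n. r = of_nat n) False sequentially" for r :: rat
    by (intro limitin_eventually) auto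
  then have "limitin lamp_topology ?c \<one>\<^bsub>lamp_group\<^esub> sequentially"
    by (simp add: lamp_topology_def limitin_pairwise lamp_simps o_def euclidean_bool_fun
        limitin_componentwise)
  then have "g \<in> contraction_subgroup lamp_group lamp_topology (\<lambda>_. False, 1)"
    by (simp add: contraction_subgroup_def conj) (simp add: lamp_simps)
  then have "g = \<one>\<^bsub>lamp_group\<^esub>"
    using triv by simp
  then show False
    by (auto simp: g_def lamp_simps fun_eq_iff)
qed

text \<open>The rationals are divisible, and taking \<open>Suc\<close> as the exponent sequence
  avoids the exponent 0.\<close>

lemma infinitely_divisible_lamp_lattice:
  assumes "h \<in> lamp_lattice"
  shows "infinitely_divisible lamp_group h"
proof -
  obtain q where "h = (\<lambda>_. False, q)"
    using assms by (auto simp: lamp_lattice_def)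
  moreover have "(\<lambda>_. False, q / of_nat (Suc k)) [^]\<^bsub>lamp_group\<^esub> Suc k = (\<lambda>_. False, q)" for k
    unfolding lamp_pow by (simp del: of_nat_Suc)
  ultimately show ?thesis
    unfolding infinitely_divisible_def
    by (intro exI[of _ Suc] exI[of _ "\<lambda>k. (\<lambda>_. False, q / of_nat (Suc k))"])
      (simp add: strict_mono_Suc_iff lamp_simps(1) del: of_nat_Suc lamp.nat_pow_Suc)
qed

lemma lamp_lcos: "x <#\<^bsub>lamp_group\<^esub> lamp_lattice = lamp_coset (fst x)"
proof -
  have "\<exists>s. q = snd x + s" for q
    by (intro exI[of _ "q - snd x"]) simp
  then show ?thesis
    by (auto simp: l_coset_def lamp_lattice_def lamp_coset_def lamp_simps)
qed

lemma inj_lamp_coset: "inj lamp_coset"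
  by (auto simp: inj_def lamp_coset_def)

text \<open>On parameters the group acts by a shift of coordinates and a flip, the maps treated in
  \<open>coin_measure_invariant\<close>.\<close>

lemma translate_lamp_coset:
  "x <#\<^bsub>lamp_group\<^esub> lamp_coset f = lamp_coset (\<lambda>r. fst x r \<noteq> f (r - snd x))"
proof -
  have "\<exists>s. q = snd x + s" for q
    by (intro exI[of _ "q - snd x"]) simp
  then show ?thesis
    by (auto simp: l_coset_def lamp_coset_def lamp_simps)
qed

section \<open>The coset space of the lattice and its invariant measure\<close>

definition lamp_space :: "((rat \<Rightarrow> bool) \<times> rat) set topology" where
  "lamp_space = coset_topology lamp_group lamp_topology lamp_lattice"

text \<open>The preimage of \<open>U\<close> in the group is a full cylinder over its parameter set,
  so \<open>lamp_coset\<close> is a homeomorphism onto the coset space.\<close>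

lemma openin_lamp_space: "openin lamp_space U \<longleftrightarrow> U \<subseteq> range lamp_coset \<and> open (lamp_coset -` U)"
proof -
  have "{x \<in> topspace lamp_topology. x <#\<^bsub>lamp_group\<^esub> lamp_lattice \<in> U} = (lamp_coset -` U) \<times> UNIV"
    by (auto simp: topspace_lamp_topology lamp_lcos)
  moreover have "(\<lambda>x. x <#\<^bsub>lamp_group\<^esub> lamp_lattice) ` topspace lamp_topology = range lamp_coset"
    by (auto simp: topspace_lamp_topology lamp_lcos image_iff)
  ultimately show ?thesis
    by (auto simp: lamp_space_def coset_topology_def openin_quotient_topology lamp_topology_def
        openin_prod_Times_iff)
qed

lemma topspace_lamp_space: "topspace lamp_space = range lamp_coset"
proof
  show "topspace lamp_space \<subseteq> range lamp_coset"
    using openin_topspace openin_lamp_space by blast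
  have "openin lamp_space (range lamp_coset)"
    by (simp add: openin_lamp_space vimage_def)
  then show "range lamp_coset \<subseteq> topspace lamp_space"
    by (rule openin_subset)
qed

lemma vimage_image_lamp_coset: "lamp_coset -` (lamp_coset ` B) = B"
  by (rule inj_vimage_image_eq[OF inj_lamp_coset])

lemma openin_lamp_coset_image: "openin lamp_space (lamp_coset ` U) \<longleftrightarrow> open U"
  by (auto simp: openin_lamp_space vimage_image_lamp_coset)

lemma continuous_lamp_coset: "continuous_map euclidean lamp_space lamp_coset"
  by (auto simp: continuous_map_def topspace_lamp_space openin_lamp_space vimage_def)

definition lamp_measure :: "((rat \<Rightarrow> bool) \<times> rat) set measure" where
  "lamp_measure = distr coin_measure (sigma (range lamp_coset) {U. openin lamp_space U}) lamp_coset"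

lemma space_lamp_measure: "space lamp_measure = range lamp_coset"
  using openin_lamp_space by (auto simp: lamp_measure_def space_measure_of_conv)

lemma sets_lamp_measure: "sets lamp_measure = sigma_sets (range lamp_coset) {U. openin lamp_space U}"
  using openin_lamp_space by (auto simp: lamp_measure_def intro!: sets_measure_of)

text \<open>The inverse of the homeomorphism is Borel, and the image of \<open>B\<close> is its
  preimage under that inverse.\<close>

lemma lamp_coset_image_sets: "lamp_coset ` B \<in> sets lamp_measure" if B: "B \<in> sets borel"
proof -
  have "inv_into UNIV lamp_coset \<in> borel_measurable lamp_measure"
  proof (rule borel_measurableI)
    fix S :: "(rat \<Rightarrow> bool) set" assume "open S"
    moreover have "inv_into UNIV lamp_coset -` S \<inter> space lamp_measure = lamp_coset ` S"
      by (auto simp: space_lamp_measure inj_lamp_coset)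
    ultimately show "inv_into UNIV lamp_coset -` S \<inter> space lamp_measure \<in> sets lamp_measure"
      using openin_lamp_coset_image by (auto simp: sets_lamp_measure intro: sigma_sets.Basic)
  qed
  moreover have "inv_into UNIV lamp_coset -` B \<inter> space lamp_measure = lamp_coset ` B"
    by (auto simp: space_lamp_measure inj_lamp_coset)
  ultimately show ?thesis
    using measurable_sets[OF _ B] by metis
qed

lemma lamp_coset_measurable:
  "lamp_coset \<in> coin_measure \<rightarrow>\<^sub>M sigma (range lamp_coset) {U. openin lamp_space U}"
proof (rule measurable_sigma_sets[of _ "range lamp_coset" "{U. openin lamp_space U}"])
  fix A assume "A \<in> {U. openin lamp_space U}"
  then show "lamp_coset -` A \<inter> space coin_measure \<in> sets coin_measure"
    by (auto simp: openin_lamp_space sets_coin_measure space_coin_measure)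
qed (use openin_lamp_space in \<open>auto intro!: sets_measure_of\<close>)

lemma vimage_lamp_coset_sets: "lamp_coset -` A \<in> sets borel" if "A \<in> sets lamp_measure"
  using that measurable_sets[OF lamp_coset_measurable, of A]
  by (simp add: lamp_measure_def sets_coin_measure space_coin_measure)

lemma emeasure_lamp_measure:
  "emeasure lamp_measure A = emeasure coin_measure (lamp_coset -` A)" if "A \<in> sets lamp_measure"
  using that emeasure_distr[OF lamp_coset_measurable, of A]
  by (simp add: lamp_measure_def space_coin_measure)

lemma prob_space_lamp_measure: "prob_space lamp_measure"
  unfolding lamp_measure_def
  by (rule prob_space.prob_space_distr[OF prob_space_coin_measure lamp_coset_measurable])

lemma lamp_set_eq_image:
  assumes "A \<subseteq> range lamp_coset"
  shows "lamp_coset ` (lamp_coset -` A) = A"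
  using assms by auto

text \<open>Regularity of \<open>coin_measure\<close> is carried over by the homeomorphism
  \<open>lamp_coset\<close>, which matches open and compact sets on both sides.\<close>

lemma radon_lamp_measure: "radon_measure lamp_space lamp_measure"
  unfolding radon_measure_def
proof (intro conjI ballI allI impI)
  interpret P: prob_space lamp_measure
    by (rule prob_space_lamp_measure)
  interpret C: prob_space "coin_measure :: (rat \<Rightarrow> bool) measure"
    by (rule prob_space_coin_measure)
  show "space lamp_measure = topspace lamp_space"
    by (simp add: space_lamp_measure topspace_lamp_space)
  show sets: "sets lamp_measure = sigma_sets (topspace lamp_space) {U. openin lamp_space U}"
    by (simp add: sets_lamp_measure topspace_lamp_space)
  show "emeasure lamp_measure K < \<infinity>" for K
    by (simp add: P.emeasure_eq_measure)
  have open_sets: "U \<in> sets lamp_measure" if "openin lamp_space U" for U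
    using that by (auto simp: sets_lamp_measure intro: sigma_sets.Basic)
  have subset: "A \<subseteq> range lamp_coset" if "A \<in> sets lamp_measure" for A
    using sets.sets_into_space[OF that] by (simp add: space_lamp_measure)
  show "emeasure lamp_measure A = (INF U \<in> {U. openin lamp_space U \<and> A \<subseteq> U}. emeasure lamp_measure U)"
    if A: "A \<in> sets lamp_measure" for A
  proof (rule antisym)
    show "emeasure lamp_measure A \<le> (INF U \<in> {U. openin lamp_space U \<and> A \<subseteq> U}. emeasure lamp_measure U)"
      using open_sets by (intro INF_greatest emeasure_mono) auto
    have "(INF U \<in> {U. openin lamp_space U \<and> A \<subseteq> U}. emeasure lamp_measure U) \<le>
        (INF U \<in> {U. lamp_coset -` A \<subseteq> U \<and> open U}. emeasure coin_measure U)"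
    proof (rule INF_mono)
      fix U assume U: "U \<in> {U. lamp_coset -` A \<subseteq> U \<and> open U}"
      then have "lamp_coset ` (lamp_coset -` A) \<subseteq> lamp_coset ` U"
        by (intro image_mono) simp
      then have "openin lamp_space (lamp_coset ` U)" "A \<subseteq> lamp_coset ` U"
        using U unfolding lamp_set_eq_image[OF subset[OF A]] by (simp_all add: openin_lamp_coset_image)
      moreover from this have "emeasure lamp_measure (lamp_coset ` U) = emeasure coin_measure U"
        using emeasure_lamp_measure[OF open_sets] by (simp add: vimage_image_lamp_coset)
      ultimately show "\<exists>V\<in>{U. openin lamp_space U \<and> A \<subseteq> U}. emeasure lamp_measure V \<le> emeasure coin_measure U"
        by (intro bexI[of _ "lamp_coset ` U"]) auto
    qed
    also have "\<dots> = emeasure coin_measure (lamp_coset -` A)"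
      by (rule bool_fun_outer_regular[symmetric, OF sets_coin_measure C.finite_measure_axioms
            vimage_lamp_coset_sets[OF A]])
    also have "\<dots> = emeasure lamp_measure A"
      by (rule emeasure_lamp_measure[symmetric, OF A])
    finally show "(INF U \<in> {U. openin lamp_space U \<and> A \<subseteq> U}. emeasure lamp_measure U) \<le> emeasure lamp_measure A" .
  qed
  show "emeasure lamp_measure A = (SUP K \<in> {K. compactin lamp_space K \<and> K \<subseteq> A}. emeasure lamp_measure K)"
    if "openin lamp_space A" for A
  proof (rule antisym)
    have A: "A \<in> sets lamp_measure"
      by (rule open_sets[OF that])
    show "(SUP K \<in> {K. compactin lamp_space K \<and> K \<subseteq> A}. emeasure lamp_measure K) \<le> emeasure lamp_measure A"
      using A by (intro SUP_least emeasure_mono) auto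
    have "emeasure lamp_measure A = emeasure coin_measure (lamp_coset -` A)"
      by (rule emeasure_lamp_measure[OF A])
    also have "\<dots> = (SUP K \<in> {K. K \<subseteq> lamp_coset -` A \<and> compact K}. emeasure coin_measure K)"
      by (rule bool_fun_inner_regular[OF sets_coin_measure C.finite_measure_axioms
            vimage_lamp_coset_sets[OF A]])
    also have "\<dots> \<le> (SUP K \<in> {K. compactin lamp_space K \<and> K \<subseteq> A}. emeasure lamp_measure K)"
    proof (rule SUP_mono)
      fix K assume K: "K \<in> {K. K \<subseteq> lamp_coset -` A \<and> compact K}"
      then have "compactin lamp_space (lamp_coset ` K)" "lamp_coset ` K \<subseteq> A"
        by (auto intro!: image_compactin[OF _ continuous_lamp_coset])
      moreover have "K \<in> sets borel"
        using K compactin_imp_closedin[OF Hausdorff_space_bool_fun, of K] by (auto intro: borel_closed)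
      then have "emeasure lamp_measure (lamp_coset ` K) = emeasure coin_measure K"
        using emeasure_lamp_measure[OF lamp_coset_image_sets] by (simp add: vimage_image_lamp_coset)
      ultimately show "\<exists>L\<in>{K. compactin lamp_space K \<and> K \<subseteq> A}. emeasure coin_measure K \<le> emeasure lamp_measure L"
        by (intro bexI[of _ "lamp_coset ` K"]) auto
    qed
    finally show "emeasure lamp_measure A \<le> (SUP K \<in> {K. compactin lamp_space K \<and> K \<subseteq> A}. emeasure lamp_measure K)" .
  qed
qed

lemma invariant_lamp_measure: "invariant_coset_measure lamp_group lamp_measure"
  unfolding invariant_coset_measure_def
proof (intro ballI)
  fix x A assume A: "A \<in> sets lamp_measure"
  \<comment> \<open>\<open>s\<close> is the action of \<open>x\<close> on parameters and
    \<open>t\<close> its inverse; images under \<open>s\<close> become preimages under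
    \<open>t\<close>, the form in which invariance of \<open>coin_measure\<close> is stated.\<close>
  define s t where "s f = (\<lambda>r. fst x r \<noteq> f (r - snd x))"
    and "t f = (\<lambda>r. fst x (r + snd x) \<noteq> f (r + snd x))" for f :: "rat \<Rightarrow> bool"
  let ?B = "lamp_coset -` A"
  have B: "?B \<in> sets borel"
    by (rule vimage_lamp_coset_sets[OF A])
  have st: "s (t f) = f" "t (s f) = f" for f
    by (auto simp: s_def t_def)
  have "A = lamp_coset ` ?B"
    using lamp_set_eq_image[of A] sets.sets_into_space[OF A] by (metis space_lamp_measure)
  then have "(\<lambda>C. x <#\<^bsub>lamp_group\<^esub> C) ` A = (\<lambda>C. x <#\<^bsub>lamp_group\<^esub> C) ` lamp_coset ` ?B"
    by (rule arg_cong)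
  also have "\<dots> = lamp_coset ` s ` ?B"
    by (simp only: image_image translate_lamp_coset s_def)
  also have "s ` ?B = t -` ?B"
  proof
    show "t -` ?B \<subseteq> s ` ?B"
    proof
      fix f assume "f \<in> t -` ?B"
      then show "f \<in> s ` ?B"
        by (intro image_eqI[of _ _ "t f"]) (simp_all add: st)
    qed
  qed (auto simp: st)
  finally have image: "(\<lambda>C. x <#\<^bsub>lamp_group\<^esub> C) ` A = lamp_coset ` t -` ?B" .
  have "t -` ?B \<in> sets borel"
    using measurable_sets[OF measurable_xor_reindex[of "\<lambda>r. fst x (r + snd x)" "\<lambda>r. r + snd x"], of ?B] B
    by (simp add: sets_coin_measure space_coin_measure t_def[abs_def])
  then have "emeasure lamp_measure (lamp_coset ` t -` ?B) = emeasure coin_measure (t -` ?B)"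
    using emeasure_lamp_measure[OF lamp_coset_image_sets] by (simp add: vimage_image_lamp_coset)
  also have "\<dots> = emeasure coin_measure ?B"
    unfolding t_def[abs_def]
    by (rule coin_measure_invariant[OF _ B]) (rule bij_plus_right)
  also have "\<dots> = emeasure lamp_measure A"
    by (rule emeasure_lamp_measure[OF A, symmetric])
  finally show "emeasure lamp_measure ((\<lambda>C. x <#\<^bsub>lamp_group\<^esub> C) ` A) = emeasure lamp_measure A"
    by (simp add: image)
qed

lemma lattice_lamp: "lattice_subgroup lamp_group lamp_topology lamp_lattice"
  unfolding lattice_subgroup_def
proof (intro conjI exI)
  show "subgroup lamp_lattice lamp_group"
    by (rule lamp.subgroupI) (auto simp: lamp_lattice_def lamp_simps lamp_inv)
  have "closedin (euclidean :: (rat \<Rightarrow> bool) topology) {\<lambda>_. False}"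
    by (rule closedin_Hausdorff_singleton[OF Hausdorff_space_bool_fun]) simp
  then show "closedin lamp_topology lamp_lattice"
    by (simp add: lamp_lattice_def lamp_topology_def closedin_prod_Times_iff)
  have "openin (subtopology lamp_topology lamp_lattice) {x}" if "x \<in> lamp_lattice" for x
  proof -
    \<comment> \<open>This open slice meets the lattice only in \<open>x\<close>, which gives
      discreteness.\<close>
    have "openin lamp_topology (UNIV \<times> {snd x})"
      by (simp add: lamp_topology_def openin_prod_Times_iff)
    moreover have "{x} = (UNIV \<times> {snd x}) \<inter> lamp_lattice"
      using that by (auto simp: lamp_lattice_def)
    ultimately show ?thesis
      by (metis openin_subtopology)
  qed
  then show "subtopology lamp_topology lamp_lattice = discrete_topology lamp_lattice"
    by (subst eq_commute) (simp add: discrete_topology_unique topspace_lamp_topology)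
  interpret P: prob_space lamp_measure
    by (rule prob_space_lamp_measure)
  show "radon_measure (coset_topology lamp_group lamp_topology lamp_lattice) lamp_measure"
    using radon_lamp_measure by (simp add: lamp_space_def)
  show "invariant_coset_measure lamp_group lamp_measure"
    by (rule invariant_lamp_measure)
  show "finite_measure lamp_measure"
    by (rule P.finite_measure_axioms)
  show "emeasure lamp_measure (space lamp_measure) \<noteq> 0"
    by (simp add: P.emeasure_space_1)
qed

theorem proposition2p8:
  shows "(\<forall>(G :: ('a, 'b) monoid_scheme) (T :: 'a topology).
            tdlc_group G T \<longrightarrow>
            (\<exists>H. lattice_subgroup G T H \<and> (\<forall>h \<in> H. infinitely_divisible G h)) \<longrightarrow>
            uniscalar G T) \<and>
         (\<exists>(G :: ((rat \<Rightarrow> bool) \<times> rat) monoid) (T :: ((rat \<Rightarrow> bool) \<times> rat) topology).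
            tdlc_group G T \<and>
            (\<exists>H. lattice_subgroup G T H \<and> (\<forall>h \<in> H. infinitely_divisible G h)) \<and>
            \<not> anisotropic G T)"
proof (intro conjI allI impI)
  fix G :: "('a, 'b) monoid_scheme" and T :: "'a topology"
  assume "tdlc_group G T" "\<exists>H. lattice_subgroup G T H \<and> (\<forall>h\<in>H. infinitely_divisible G h)"
  then show "uniscalar G T"
    using tdlc_group.uniscalar_of_divisible_lattice by blast
next
  show "\<exists>(G :: ((rat \<Rightarrow> bool) \<times> rat) monoid) T. tdlc_group G T \<and>
      (\<exists>H. lattice_subgroup G T H \<and> (\<forall>h\<in>H. infinitely_divisible G h)) \<and> \<not> anisotropic G T"
    using tdlc_group_lamp lattice_lamp infinitely_divisible_lamp_lattice not_anisotropic_lamp by blast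
qed

end
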